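(* Any algorithm $\mathcal{A}$ for the Rectangulation problem can be transformed (in polynomial time) into an algorithm $\mathcal{A}'$ for the Satisfied Superset problem such that for all inputs $X$ (permutation point sets) we have $\mathcal{A}'(X) = O(\mathcal{A}(X))$.
   Context: Permutation point sets: for a permutation $(x_1,\dots,x_n)$ of $[n]=\{1,\dots,n\}$, the associated point set is $X=\{(x_i,i): i\in[n]\}$. An algorithm for a problem below takes any permutation point set $X$ as input and outputs a feasible solution; $\mathcal{A}(X)$ denotes its cost on $X$. Satisfied Superset problem: a point set $Y\subseteq[n]\times[n]$ is satisfied if for any two points $a,b\in Y$, either $a,b$ lie on a common horizontal or vertical line, or the closed axis-parallel rectangle with corners $a$ and $b$ contains some point of $Y\setminus\{a,b\}$ (possibly on its boundary). Given $X$ of size $n$, an algorithm outputs a satisfied $Y$ with $X\subseteq Y\subseteq[n]\times[n]$; its cost is $|Y|$. Rectangulation problem: let $S=\{0,1,\dots,n+1\}^2$, corner points $C=\{(0,0),(0,n+1),(n+1,0),(n+1,n+1)\}$, margin points $M=\{(i,0),(i,n+1),(0,i),(n+1,i): i\in[n]\}$; points of $[n]\times[n]$ are non-margin. A state $(P,L)$ consists of $P\subseteq S\setminus C$ and a set $L$ of horizontal and vertical segments with endpoints in $P$. It is valid iff (i) each segment of $L$ contains exactly two points of $P$, namely its endpoints; (ii) no two segments of $L$ intersect except possibly at endpoints; (iii) (elbow-free) each non-margin point of $P$ lies on at least two segments of $L$, and if it lies on exactly two, they have the same orientation (both horizontal or both vertical). The initial state for $X$ is $P_0=X\cup M$ and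 $L_0$ containing, for each $(x,y)\in X$, the two vertical segments $[(x,0),(x,y)]$ and $[(x,y),(x,n+1)]$. An end state is a valid state $(P^*,L^* )$ with $P^*\supseteq P_0$ and all segments of $L^*$ horizontal, covering every point of $\{0,1,\dots,n+1\}\times[n]$. A flip $\langle a,b\rangle$ ($a,b\in S\setminus C$) transforms $(P,L)$ into $(P',L')$: $P'=P\cup\{a,b\}$, $L'=L\cup\{[a,b]\}$, and any segment $[x,y]\in L$ containing $a$ in its interior is replaced by $[x,a],[a,y]$ (similarly for $b$). The flip is valid if $[a,b]$ is horizontal or vertical and $(P',L')$ is valid; after a flip any number of segments may be removed, provided the state stays valid (removals cost nothing). An algorithm transforms the initial state into some end state by valid flips; its cost is the number of flips. *)

theory Defs
  imports Complex_Main "HOL-Combinatorics.Multiset_Permutations"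
begin

section \<open>Points and permutation point sets\<close>

type_synonym point = "nat \<times> nat"

definition is_permutation :: "nat list \<Rightarrow> bool" where
  "is_permutation xs \<longleftrightarrow> xs \<in> permutations_of_set {1..length xs}"

text \<open>Lists are indexed from \<open>0\<close>, coordinates from \<open>1\<close>.\<close>

definition point_set :: "nat list \<Rightarrow> point set" where
  "point_set xs = {(xs ! (i - 1), i) | i. i \<in> {1..length xs}}"

definition box :: "point \<Rightarrow> point \<Rightarrow> point set" where
  "box a b = {min (fst a) (fst b)..max (fst a) (fst b)} \<times> {min (snd a) (snd b)..max (snd a) (snd b)}"


section \<open>Satisfied Superset\<close>

definition satisfied :: "point set \<Rightarrow> bool" where
  "satisfied Y \<longleftrightarrow>
     (\<forall>a\<in>Y. \<forall>b\<in>Y. fst a = fst b \<or> snd a = snd b \<or> box a b \<inter> (Y - {a, b}) \<noteq> {})"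

text \<open>A solution is written down as a list of points, which represents the set of its members.\<close>

definition superset_solution :: "nat list \<Rightarrow> point list \<Rightarrow> bool" where
  "superset_solution xs ys \<longleftrightarrow>
     point_set xs \<subseteq> set ys \<and> set ys \<subseteq> {1..length xs} \<times> {1..length xs} \<and> satisfied (set ys)"

definition superset_cost :: "point list \<Rightarrow> nat" where
  "superset_cost ys = card (set ys)"

definition superset_algorithm :: "(nat list \<Rightarrow> point list) \<Rightarrow> bool" where
  "superset_algorithm B \<longleftrightarrow> (\<forall>xs. is_permutation xs \<longrightarrow> superset_solution xs (B xs))"


section \<open>Rectangulation\<close>

definition grid :: "nat \<Rightarrow> point set" where
  "grid n = {0..n + 1} \<times> {0..n + 1}"

definition corners :: "nat \<Rightarrow> point set" where
  "corners n = {(0, 0), (0, n + 1), (n + 1, 0), (n + 1, n + 1)}"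

definition margin :: "nat \<Rightarrow> point set" where
  "margin n = (\<Union>i\<in>{1..n}. {(i, 0), (i, n + 1), (0, i), (n + 1, i)})"

definition nonmargin :: "nat \<Rightarrow> point set" where
  "nonmargin n = {1..n} \<times> {1..n}"

text \<open>
  The segment with endpoints \<open>a \<noteq> b\<close> is represented by the unordered pair \<open>{a, b}\<close>.  Geometric
  conditions are expressed through the lattice points of a segment.  This loses nothing: a horizontal
  and a vertical segment with lattice endpoints can only meet in a lattice point, and two distinct
  collinear ones overlapping in more than one point share a lattice point that is an interior point
  of one of them.
\<close>

type_synonym segment = "point set"

type_synonym state = "point set \<times> segment set"

definition horizontal :: "segment \<Rightarrow> bool" where
  "horizontal s \<longleftrightarrow> (\<exists>a b. s = {a, b} \<and> a \<noteq> b \<and> snd a = snd b)"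

definition vertical :: "segment \<Rightarrow> bool" where
  "vertical s \<longleftrightarrow> (\<exists>a b. s = {a, b} \<and> a \<noteq> b \<and> fst a = fst b)"

definition seg_points :: "segment \<Rightarrow> point set" where
  "seg_points s = (\<Union>a\<in>s. \<Union>b\<in>s. box a b)"

definition seg_interior :: "segment \<Rightarrow> point set" where
  "seg_interior s = seg_points s - s"

definition is_state :: "nat \<Rightarrow> state \<Rightarrow> bool" where
  "is_state n = (\<lambda>(P, L). P \<subseteq> grid n - corners n \<and>
     (\<forall>s\<in>L. (horizontal s \<or> vertical s) \<and> s \<subseteq> P))"

definition elbow_free :: "nat \<Rightarrow> state \<Rightarrow> bool" where
  "elbow_free n = (\<lambda>(P, L). \<forall>p \<in> P \<inter> nonmargin n.
     let I = {s \<in> L. p \<in> seg_points s}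
     in card I \<ge> 2 \<and> (card I = 2 \<longrightarrow> (\<forall>s\<in>I. horizontal s) \<or> (\<forall>s\<in>I. vertical s)))"

definition valid_state :: "nat \<Rightarrow> state \<Rightarrow> bool" where
  "valid_state n = (\<lambda>(P, L). is_state n (P, L) \<and>
     (\<forall>s\<in>L. seg_points s \<inter> P = s) \<and>
     (\<forall>s\<in>L. \<forall>t\<in>L. s \<noteq> t \<longrightarrow> seg_points s \<inter> seg_points t \<subseteq> s \<inter> t) \<and>
     elbow_free n (P, L))"

definition initial_state :: "nat list \<Rightarrow> state" where
  "initial_state xs =
     (point_set xs \<union> margin (length xs),
      \<Union>(x, y)\<in>point_set xs. {{(x, 0), (x, y)}, {(x, y), (x, length xs + 1)}})"

definition end_state :: "nat list \<Rightarrow> state \<Rightarrow> bool" where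
  "end_state xs = (\<lambda>(P, L). valid_state (length xs) (P, L) \<and>
     fst (initial_state xs) \<subseteq> P \<and> (\<forall>s\<in>L. horizontal s) \<and>
     {0..length xs + 1} \<times> {1..length xs} \<subseteq> (\<Union>s\<in>L. seg_points s))"

definition split_at :: "point \<Rightarrow> segment set \<Rightarrow> segment set" where
  "split_at c L = {s \<in> L. c \<notin> seg_interior s} \<union> {{x, c} | x s. s \<in> L \<and> c \<in> seg_interior s \<and> x \<in> s}"

definition flip :: "point \<Rightarrow> point \<Rightarrow> state \<Rightarrow> state" where
  "flip a b = (\<lambda>(P, L). (P \<union> {a, b}, insert {a, b} (split_at b (split_at a L))))"

definition valid_flip :: "nat \<Rightarrow> point \<Rightarrow> point \<Rightarrow> state \<Rightarrow> bool" where
  "valid_flip n a b st \<longleftrightarrow> a \<in> grid n - corners n \<and> b \<in> grid n - corners n \<and>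
     (horizontal {a, b} \<or> vertical {a, b}) \<and> valid_state n (flip a b st)"

text \<open>
  A move \<open>(a, b, R)\<close> is a flip \<open>\<langle>a, b\<rangle>\<close> followed by the removal of the segments listed in \<open>R\<close>, each
  given by its two endpoints.
\<close>

type_synonym move = "point \<times> point \<times> (point \<times> point) list"

inductive moves :: "nat \<Rightarrow> state \<Rightarrow> move list \<Rightarrow> state \<Rightarrow> bool" for n where
  Nil: "moves n st [] st"
| Cons: "valid_flip n a b st \<Longrightarrow> flip a b st = (P, L) \<Longrightarrow>
    removed = map (\<lambda>(c, d). {c, d}) R \<Longrightarrow> distinct removed \<Longrightarrow> set removed \<subseteq> L \<Longrightarrow>
    valid_state n (P, L - set removed) \<Longrightarrow> moves n (P, L - set removed) ms st' \<Longrightarrow>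
    moves n st ((a, b, R) # ms) st'"

definition rectangulation_solution :: "nat list \<Rightarrow> move list \<Rightarrow> bool" where
  "rectangulation_solution xs ms \<longleftrightarrow>
     (\<exists>st. moves (length xs) (initial_state xs) ms st \<and> end_state xs st)"

definition rectangulation_cost :: "move list \<Rightarrow> nat" where
  "rectangulation_cost ms = length ms"

definition rectangulation_algorithm :: "(nat list \<Rightarrow> move list) \<Rightarrow> bool" where
  "rectangulation_algorithm A \<longleftrightarrow> (\<forall>xs. is_permutation xs \<longrightarrow> rectangulation_solution xs (A xs))"


section \<open>Polynomial time\<close>

text \<open>
  The machine model is a variable-free variant of Jones' language WHILE on binary trees.  Every
  evaluation of a (sub)program is charged the sizes of its argument and of its result in addition to
  the time of its parts, so no value can outgrow the elapsed time, and time in this model is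
  polynomially related to Turing machine time.
\<close>

datatype tree = Leaf | Node tree tree

datatype prog =
    Ident
  | ConstLeaf
  | LeftSub
  | RightSub
  | EqTest
  | Join prog prog
  | Seq prog prog
  | Cond prog prog prog
  | Loop prog prog

fun left_sub :: "tree \<Rightarrow> tree" where
  "left_sub Leaf = Leaf"
| "left_sub (Node l r) = l"

fun right_sub :: "tree \<Rightarrow> tree" where
  "right_sub Leaf = Leaf"
| "right_sub (Node l r) = r"

fun eq_test :: "tree \<Rightarrow> tree" where
  "eq_test Leaf = Leaf"
| "eq_test (Node l r) = (if l = r then Node Leaf Leaf else Leaf)"

definition charge :: "tree \<Rightarrow> tree \<Rightarrow> nat" where
  "charge x y = 1 + size x + size y"

text \<open>
  \<open>exec p x y t\<close>: program \<open>p\<close> on argument \<open>x\<close> halts with result \<open>y\<close> after time \<open>t\<close>.  In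
  conditionals and loops, \<open>Leaf\<close> means false and every other tree means true.
\<close>

inductive exec :: "prog \<Rightarrow> tree \<Rightarrow> tree \<Rightarrow> nat \<Rightarrow> bool" where
  Ident: "exec Ident x x (charge x x)"
| ConstLeaf: "exec ConstLeaf x Leaf (charge x Leaf)"
| LeftSub: "exec LeftSub x (left_sub x) (charge x (left_sub x))"
| RightSub: "exec RightSub x (right_sub x) (charge x (right_sub x))"
| EqTest: "exec EqTest x (eq_test x) (charge x (eq_test x))"
| Join: "exec p x y t \<Longrightarrow> exec q x z u \<Longrightarrow> exec (Join p q) x (Node y z) (t + u + charge x (Node y z))"
| Seq: "exec p x y t \<Longrightarrow> exec q y z u \<Longrightarrow> exec (Seq p q) x z (t + u + charge x z)"
| CondTrue: "exec b x v t \<Longrightarrow> v \<noteq> Leaf \<Longrightarrow> exec p x y u \<Longrightarrow> exec (Cond b p q) x y (t + u + charge x y)"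
| CondFalse: "exec b x Leaf t \<Longrightarrow> exec q x y u \<Longrightarrow> exec (Cond b p q) x y (t + u + charge x y)"
| LoopExit: "exec b x Leaf t \<Longrightarrow> exec (Loop b p) x x (t + charge x x)"
| LoopStep: "exec b x v t \<Longrightarrow> v \<noteq> Leaf \<Longrightarrow> exec p x y u \<Longrightarrow> exec (Loop b p) y z w \<Longrightarrow>
    exec (Loop b p) x z (t + u + w + charge x z)"

text \<open>
  Numbers are encoded in unary.  All coordinates are at most \<open>n + 1\<close> and every instance lists \<open>n\<close>
  numbers, so this is polynomially equivalent to a binary encoding.
\<close>

fun enc_nat :: "nat \<Rightarrow> tree" where
  "enc_nat 0 = Leaf"
| "enc_nat (Suc k) = Node Leaf (enc_nat k)"

fun enc_list :: "('a \<Rightarrow> tree) \<Rightarrow> 'a list \<Rightarrow> tree" where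
  "enc_list f [] = Leaf"
| "enc_list f (x # xs) = Node (f x) (enc_list f xs)"

fun enc_pair :: "('a \<Rightarrow> tree) \<Rightarrow> ('b \<Rightarrow> tree) \<Rightarrow> 'a \<times> 'b \<Rightarrow> tree" where
  "enc_pair f g (x, y) = Node (f x) (g y)"

definition enc_point :: "point \<Rightarrow> tree" where
  "enc_point = enc_pair enc_nat enc_nat"

definition enc_move :: "move \<Rightarrow> tree" where
  "enc_move = enc_pair enc_point (enc_pair enc_point (enc_list (enc_pair enc_point enc_point)))"

definition enc_instance :: "nat list \<Rightarrow> move list \<Rightarrow> tree" where
  "enc_instance xs ms = Node (enc_list enc_nat xs) (enc_list enc_move ms)"

text \<open>
  \<open>T\<close> receives the input permutation and a complete execution of a Rectangulation algorithm on it.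
\<close>

definition poly_time_transformation :: "(nat list \<Rightarrow> move list \<Rightarrow> point list) \<Rightarrow> bool" where
  "poly_time_transformation T \<longleftrightarrow> (\<exists>p c d. \<forall>xs ms.
     is_permutation xs \<and> rectangulation_solution xs ms \<longrightarrow>
     (\<exists>t. exec p (enc_instance xs ms) (enc_list enc_point (T xs ms)) t \<and>
          t \<le> c * size (enc_instance xs ms) ^ d + c))"

end

theory Submission
  imports Defs
begin

text \<open>
  The non-margin points of the final state need not form a satisfied set, since flips may be wasted:
  vertical segments can be re-inserted after they were removed, and points can be placed in the
  interior of a segment.  Instead, every vertical unit edge carries the column it stands for.
  Initially this is its own column; an edge inserted by a vertical flip copies the label of the
  nearest labelled edge to its left, and stays unlabelled if there is none.  Thus, in the strip
  between two consecutive rows, the set of labels only shrinks.  The solution consists of the input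
  points and of all points \<open>(f, y)\<close> such that, right after a flip with endpoint \<open>(x, y)\<close>, an edge directly
  above or below that endpoint has label \<open>f\<close>; a flip creates at most four of them.

  Consider two such points \<open>(x1, y1)\<close>, \<open>(x2, y2)\<close> with \<open>x1 < x2\<close> whose box contains no further
  one, and suppose that between the two rows the label \<open>x1\<close> is lost no later than \<open>x2\<close>.  When it is
  lost, some point of row \<open>y1\<close> on an edge labelled \<open>x1\<close> must lie on a horizontal line to its right.
  That line reaches the next labelled edge, which creates a point \<open>(f, y1)\<close> with \<open>x1 < f \<le> x2\<close>, a
  contradiction.  Since all labels are lost in the end, the set is satisfied.
\<close>

section \<open>A calculus of polynomial-time functions\<close>

text \<open>Copying the nearest label on the left keeps the labels of each strip weakly increasing
  and never brings back a label that the strip has lost. The first fact confines every label met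
  between edges labelled x1 and x2 to the interval from x1 to x2. The second makes the loss of a
  label final, so a pair of positions can be settled as soon as one of its labels is gone. The
  delicate point is why a line that meets an edge labelled f in row y comes with the point (f, y),
  although edges are copied, reinserted and cut at will. The invariant says that, as long as (f, y)
  has not been produced, every edge labelled f runs straight through row y and nothing is attached
  to it there. For a copy this is seen by tracing horizontal lines in row y to the left, back to the
  edge it was copied from. Validity enters mainly as a condition on the unit edges around single
  grid points, which hides how segments are subdivided. The transformation has to be a tree program.
  It is composed of list folds, and its polynomial bound rests on a bound for the label list that
  holds throughout the run.\<close>

definition pbound :: "'a set \<Rightarrow> ('a \<Rightarrow> tree) \<Rightarrow> ('a \<Rightarrow> nat) \<Rightarrow> bool" where
  "pbound D e h \<longleftrightarrow> (\<exists>k. \<forall>x\<in>D. h x \<le> (size (e x) + 2) ^ k)"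

lemma pbound_mono: "pbound D e h' \<Longrightarrow> (\<And>x. x \<in> D \<Longrightarrow> h x \<le> h' x) \<Longrightarrow> pbound D e h"
  unfolding pbound_def by (meson order_trans)

lemma pbound_const: "pbound D e (\<lambda>_. c)"
proof -
  \<comment> \<open>The summand 2 keeps the base at least 2, so a constant can be absorbed by using
    it as the exponent.\<close>
  have "c \<le> (size (e x) + 2) ^ c" for x
    by (metis less_exp le_add2 less_imp_le_nat order_trans power_mono zero_le)
  then show ?thesis unfolding pbound_def by blast
qed

lemma pbound_size: "pbound D e (\<lambda>x. size (e x))"
  unfolding pbound_def by (rule exI[of _ 1]) simp

lemma pbound_add:
  assumes "pbound D e g" "pbound D e h"
  shows "pbound D e (\<lambda>x. g x + h x)"
proof -
  obtain i j where i: "\<And>x. x \<in> D \<Longrightarrow> g x \<le> (size (e x) + 2) ^ i"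
    and j: "\<And>x. x \<in> D \<Longrightarrow> h x \<le> (size (e x) + 2) ^ j"
    using assms unfolding pbound_def by blast
  have "g x + h x \<le> (size (e x) + 2) ^ Suc (max i j)" if "x \<in> D" for x
  proof -
    have "g x \<le> (size (e x) + 2) ^ max i j" "h x \<le> (size (e x) + 2) ^ max i j"
      using i[OF that] j[OF that] by (meson le_add2 le_trans max.cobounded1 max.cobounded2
          one_le_numeral power_increasing)+
    then show ?thesis by (metis add_mono mult_2 mult_le_mono1 le_add2 order_trans power_Suc)
  qed
  then show ?thesis unfolding pbound_def by blast
qed

lemma pbound_mult:
  assumes "pbound D e g" "pbound D e h"
  shows "pbound D e (\<lambda>x. g x * h x)"
proof -
  obtain i j where "\<And>x. x \<in> D \<Longrightarrow> g x \<le> (size (e x) + 2) ^ i"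
    "\<And>x. x \<in> D \<Longrightarrow> h x \<le> (size (e x) + 2) ^ j"
    using assms unfolding pbound_def by blast
  then have "\<forall>x\<in>D. g x * h x \<le> (size (e x) + 2) ^ (i + j)"
    by (simp add: mult_mono power_add)
  then show ?thesis unfolding pbound_def by blast
qed

lemma pbound_comp:
  assumes "pbound E e' h" and "pbound D e (\<lambda>x. size (e' (f x)))" and "\<And>x. x \<in> D \<Longrightarrow> f x \<in> E"
  shows "pbound D e (\<lambda>x. h (f x))"
proof -
  obtain i j where i: "\<And>y. y \<in> E \<Longrightarrow> h y \<le> (size (e' y) + 2) ^ i"
    and j: "\<And>x. x \<in> D \<Longrightarrow> size (e' (f x)) \<le> (size (e x) + 2) ^ j"
    using assms unfolding pbound_def by blast
  have "h (f x) \<le> (size (e x) + 2) ^ ((j + 2) * i)" if "x \<in> D" for x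
  proof -
    let ?s = "size (e x) + 2"
    \<comment> \<open>The size of the intermediate value enters the outer bound with its own summand
      2; the two extra factors \<open>?s\<close> pay for it.\<close>
    have "4 * ?s ^ j \<le> (?s * ?s) * ?s ^ j"
      by (intro mult_right_mono) auto
    moreover have "1 \<le> ?s ^ j" by simp
    moreover have "?s ^ (j + 2) = (?s * ?s) * ?s ^ j"
      by (simp only: power_add power2_eq_square mult.commute)
    ultimately have "size (e' (f x)) + 2 \<le> ?s ^ (j + 2)"
      using j[OF that] by linarith
    then have "(size (e' (f x)) + 2) ^ i \<le> (?s ^ (j + 2)) ^ i"
      by (rule power_mono) simp
    with i[OF assms(3)[OF that]] show ?thesis by (metis order_trans power_mult)
  qed
  then show ?thesis unfolding pbound_def by blast
qed

lemma pbound_Suc: "pbound D e g \<Longrightarrow> pbound D e (\<lambda>x. Suc (g x))"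
  using pbound_add[OF pbound_const[of D e 1]] by simp

lemmas pbound_intros = pbound_const pbound_size pbound_add pbound_mult pbound_Suc

section \<open>Functions computable in polynomial time relative to encodings\<close>

definition ptime :: "'a set \<Rightarrow> ('a \<Rightarrow> tree) \<Rightarrow> ('b \<Rightarrow> tree) \<Rightarrow> ('a \<Rightarrow> 'b) \<Rightarrow> bool" where
  "ptime D e e' f \<longleftrightarrow> (\<exists>p T. (\<forall>x\<in>D. exec p (e x) (e' (f x)) (T x)) \<and> pbound D e T)"

lemma exec_charge: "exec p x y t \<Longrightarrow> charge x y \<le> t"
  by (induction rule: exec.induct) (auto simp: charge_def)

text \<open>Each evaluation is charged for its result, so a bound on the time is also a bound on the
  output size. Composition depends on this.\<close>

lemma ptime_size: "ptime D e e' f \<Longrightarrow> pbound D e (\<lambda>x. size (e' (f x)))"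
  unfolding ptime_def using exec_charge
  by (force intro: pbound_mono simp: charge_def)

lemma ptime_exec:
  assumes "ptime D e e' f"
  obtains p T where "\<And>x. x \<in> D \<Longrightarrow> exec p (e x) (e' (f x)) (T x)" and "pbound D e T"
    and "pbound D e (\<lambda>x. size (e' (f x)))"
  using assms ptime_size[OF assms] unfolding ptime_def by blast

lemma ptimeI:
  "(\<And>x. x \<in> D \<Longrightarrow> exec p (e x) (e' (f x)) (T x)) \<Longrightarrow> pbound D e T \<Longrightarrow> ptime D e e' f"
  unfolding ptime_def by blast

lemma ptime_recode:
  "ptime D e e' f \<Longrightarrow> (\<And>x. x \<in> D \<Longrightarrow> e' (f x) = e'' (g x)) \<Longrightarrow> ptime D e e'' g"
  unfolding ptime_def by fastforce

lemma ptime_comp: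
  assumes f: "ptime D e e' f" and g: "ptime E e' e'' g" and E: "\<And>x. x \<in> D \<Longrightarrow> f x \<in> E"
  shows "ptime D e e'' (\<lambda>x. g (f x))"
proof -
  obtain p T where p: "\<And>x. x \<in> D \<Longrightarrow> exec p (e x) (e' (f x)) (T x)" and T: "pbound D e T"
    and s: "pbound D e (\<lambda>x. size (e' (f x)))"
    using ptime_exec[OF f] by blast
  obtain q U where q: "\<And>x. x \<in> E \<Longrightarrow> exec q (e' x) (e'' (g x)) (U x)" and U: "pbound E e' U"
    and s': "pbound E e' (\<lambda>x. size (e'' (g x)))"
    using ptime_exec[OF g] by blast
  show ?thesis
  proof (rule ptimeI)
    show "exec (Seq p q) (e x) (e'' (g (f x))) (T x + U (f x) + charge (e x) (e'' (g (f x))))"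
      if "x \<in> D" for x
      using exec.Seq[OF p[OF that] q[OF E[OF that]]] .
    show "pbound D e (\<lambda>x. T x + U (f x) + charge (e x) (e'' (g (f x))))"
      unfolding charge_def
      by (intro pbound_intros T pbound_comp[OF U s E] pbound_comp[OF s' s E])
  qed
qed

lemma ptime_id: "ptime D e e (\<lambda>x. x)"
  by (rule ptimeI[OF exec.Ident]) (auto simp: charge_def intro!: pbound_intros)

lemma ptime_Leaf:
  assumes "\<And>x. x \<in> D \<Longrightarrow> e' (f x) = Leaf"
  shows "ptime D e e' f"
proof (rule ptimeI)
  show "exec ConstLeaf (e x) (e' (f x)) (charge (e x) Leaf)" if "x \<in> D" for x
    using exec.ConstLeaf[of "e x"] assms[OF that] by simp
  show "pbound D e (\<lambda>x. charge (e x) Leaf)"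
    unfolding charge_def by (intro pbound_intros)
qed

lemma ptime_Node:
  assumes f: "ptime D e e1 f" and g: "ptime D e e2 g"
    and h: "\<And>x. x \<in> D \<Longrightarrow> e' (h x) = Node (e1 (f x)) (e2 (g x))"
  shows "ptime D e e' h"
proof -
  obtain p T where p: "\<And>x. x \<in> D \<Longrightarrow> exec p (e x) (e1 (f x)) (T x)" and T: "pbound D e T"
    and s: "pbound D e (\<lambda>x. size (e1 (f x)))"
    using ptime_exec[OF f] by blast
  obtain q U where q: "\<And>x. x \<in> D \<Longrightarrow> exec q (e x) (e2 (g x)) (U x)" and U: "pbound D e U"
    and s': "pbound D e (\<lambda>x. size (e2 (g x)))"
    using ptime_exec[OF g] by blast
  have "exec (Join p q) (e x) (e' (h x))
      (T x + U x + (1 + size (e x) + (size (e1 (f x)) + size (e2 (g x)) + 1)))" if "x \<in> D" for x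
    using exec.Join[OF p[OF that] q[OF that]] h[OF that] by (simp add: charge_def)
  moreover have "pbound D e (\<lambda>x. T x + U x + (1 + size (e x) + (size (e1 (f x)) + size (e2 (g x)) + 1)))"
    by (intro pbound_intros T U s s')
  ultimately show ?thesis by (rule ptimeI)
qed

lemma size_left_sub: "size (left_sub t) \<le> size t"
  by (cases t) auto

lemma size_right_sub: "size (right_sub t) \<le> size t"
  by (cases t) auto

lemma ptime_left:
  assumes "ptime D e e1 f" and "\<And>x. x \<in> D \<Longrightarrow> e' (h x) = left_sub (e1 (f x))"
  shows "ptime D e e' h"
proof -
  have "ptime UNIV e1 (\<lambda>t. t) (\<lambda>y. left_sub (e1 y))"
  proof (rule ptimeI)
    show "exec LeftSub (e1 y) (left_sub (e1 y)) (charge (e1 y) (left_sub (e1 y)))" for y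
      by (rule exec.LeftSub)
    have "pbound UNIV e1 (\<lambda>y. 1 + size (e1 y) + size (e1 y))" by (intro pbound_intros)
    then show "pbound UNIV e1 (\<lambda>y. charge (e1 y) (left_sub (e1 y)))"
      by (rule pbound_mono) (simp add: charge_def size_left_sub)
  qed
  from ptime_comp[OF assms(1) this] show ?thesis
    by (rule ptime_recode) (simp_all add: assms(2))
qed

lemma ptime_right:
  assumes "ptime D e e1 f" and "\<And>x. x \<in> D \<Longrightarrow> e' (h x) = right_sub (e1 (f x))"
  shows "ptime D e e' h"
proof -
  have "ptime UNIV e1 (\<lambda>t. t) (\<lambda>y. right_sub (e1 y))"
  proof (rule ptimeI)
    show "exec RightSub (e1 y) (right_sub (e1 y)) (charge (e1 y) (right_sub (e1 y)))" for y
      by (rule exec.RightSub)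
    have "pbound UNIV e1 (\<lambda>y. 1 + size (e1 y) + size (e1 y))" by (intro pbound_intros)
    then show "pbound UNIV e1 (\<lambda>y. charge (e1 y) (right_sub (e1 y)))"
      by (rule pbound_mono) (simp add: charge_def size_right_sub)
  qed
  from ptime_comp[OF assms(1) this] show ?thesis
    by (rule ptime_recode) (simp_all add: assms(2))
qed

text \<open>Conditionals accept every tree other than \<open>Leaf\<close> as true. Fixing the one
  that \<open>eq_test\<close> returns gives predicates a proper encoding.\<close>

fun enc_bool :: "bool \<Rightarrow> tree" where
  "enc_bool True = Node Leaf Leaf"
| "enc_bool False = Leaf"

lemma ptime_if:
  assumes b: "ptime D e enc_bool b" and f: "ptime D e e' f" and g: "ptime D e e' g"
  shows "ptime D e e' (\<lambda>x. if b x then f x else g x)"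
proof -
  obtain r V where r: "\<And>x. x \<in> D \<Longrightarrow> exec r (e x) (enc_bool (b x)) (V x)" and V: "pbound D e V"
    using ptime_exec[OF b] by blast
  obtain p T where p: "\<And>x. x \<in> D \<Longrightarrow> exec p (e x) (e' (f x)) (T x)" and T: "pbound D e T"
    and s: "pbound D e (\<lambda>x. size (e' (f x)))"
    using ptime_exec[OF f] by blast
  obtain q U where q: "\<And>x. x \<in> D \<Longrightarrow> exec q (e x) (e' (g x)) (U x)" and U: "pbound D e U"
    and s': "pbound D e (\<lambda>x. size (e' (g x)))"
    using ptime_exec[OF g] by blast
  let ?t = "\<lambda>x. V x + (if b x then T x else U x) + charge (e x) (e' (if b x then f x else g x))"
  show ?thesis
  proof (rule ptimeI)
    show "exec (Cond r p q) (e x) (e' (if b x then f x else g x)) (?t x)" if "x \<in> D" for x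
      using r[OF that] p[OF that] q[OF that]
      by (cases "b x") (auto intro: exec.CondTrue exec.CondFalse)
    have "pbound D e (\<lambda>x. V x + T x + U x + (1 + size (e x) + size (e' (f x)) + size (e' (g x))))"
      by (intro pbound_intros V T U s s')
    then show "pbound D e ?t"
      by (rule pbound_mono) (auto simp: charge_def)
  qed
qed

lemma ptime_eq:
  assumes f: "ptime D e e' f" and g: "ptime D e e' g" and inj: "inj e'"
  shows "ptime D e enc_bool (\<lambda>x. f x = g x)"
proof -
  have *: "eq_test (enc_pair e' e' z) = enc_bool (fst z = snd z)" for z
    by (cases z) (simp add: inj_eq[OF inj])
  have "ptime UNIV (enc_pair e' e') enc_bool (\<lambda>z. fst z = snd z)"
  proof (rule ptimeI[where p = EqTest])
    show "exec EqTest (enc_pair e' e' z) (enc_bool (fst z = snd z))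
        (charge (enc_pair e' e' z) (enc_bool (fst z = snd z)))" for z
      using exec.EqTest[of "enc_pair e' e' z"] by (simp only: *)
    show "pbound UNIV (enc_pair e' e') (\<lambda>z. charge (enc_pair e' e' z) (enc_bool (fst z = snd z)))"
    proof (rule pbound_mono)
      show "pbound UNIV (enc_pair e' e') (\<lambda>z. 1 + size (enc_pair e' e' z) + 1)"
        by (intro pbound_intros)
      show "charge (enc_pair e' e' z) (enc_bool (fst z = snd z)) \<le> 1 + size (enc_pair e' e' z) + 1" for z
        by (cases "fst z = snd z") (auto simp: charge_def)
    qed
  qed
  moreover have "ptime D e (enc_pair e' e') (\<lambda>x. (f x, g x))"
    by (rule ptime_Node[OF f g]) simp
  ultimately show ?thesis
    using ptime_comp[of D e "enc_pair e' e'" "\<lambda>x. (f x, g x)" UNIV enc_bool "\<lambda>z. fst z = snd z"] by simp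
qed

lemma ptime_True: "ptime D e enc_bool (\<lambda>_. True)"
proof -
  have L: "ptime D e (\<lambda>_::unit. Leaf) (\<lambda>_. ())" by (rule ptime_Leaf) simp
  show ?thesis by (rule ptime_Node[OF L L]) simp
qed

lemma ptime_False: "ptime D e enc_bool (\<lambda>_. False)"
  by (rule ptime_Leaf) simp

lemma ptime_not:
  assumes "ptime D e enc_bool b"
  shows "ptime D e enc_bool (\<lambda>x. \<not> b x)"
  using ptime_if[OF assms ptime_False ptime_True] by (rule ptime_recode) simp

lemma ptime_conj:
  assumes "ptime D e enc_bool b" "ptime D e enc_bool c"
  shows "ptime D e enc_bool (\<lambda>x. b x \<and> c x)"
  using ptime_if[OF assms ptime_False] by (rule ptime_recode) simp

lemma ptime_disj:
  assumes "ptime D e enc_bool b" "ptime D e enc_bool c"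
  shows "ptime D e enc_bool (\<lambda>x. b x \<or> c x)"
  using ptime_if[OF assms(1) ptime_True assms(2)] by (rule ptime_recode) simp

lemma ptime_Pair:
  "ptime D e e1 f \<Longrightarrow> ptime D e e2 g \<Longrightarrow> ptime D e (enc_pair e1 e2) (\<lambda>x. (f x, g x))"
  by (erule (1) ptime_Node) simp

lemma enc_pair_sub:
  "left_sub (enc_pair e1 e2 z) = e1 (fst z)" "right_sub (enc_pair e1 e2 z) = e2 (snd z)"
  by (cases z; simp)+

lemma ptime_fst: "ptime D e (enc_pair e1 e2) f \<Longrightarrow> ptime D e e1 (\<lambda>x. fst (f x))"
  by (erule ptime_left) (simp add: enc_pair_sub)

lemma ptime_snd: "ptime D e (enc_pair e1 e2) f \<Longrightarrow> ptime D e e2 (\<lambda>x. snd (f x))"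
  by (erule ptime_right) (simp add: enc_pair_sub)

lemma ptime_Nil: "ptime D e (enc_list e') (\<lambda>_. [])"
  by (rule ptime_Leaf) simp

lemma ptime_Cons:
  "ptime D e e' f \<Longrightarrow> ptime D e (enc_list e') g \<Longrightarrow> ptime D e (enc_list e') (\<lambda>x. f x # g x)"
  by (erule (1) ptime_Node) simp

lemma ptime_0: "ptime D e enc_nat (\<lambda>_. 0)"
  by (rule ptime_Leaf) simp

lemma ptime_Suc:
  assumes "ptime D e enc_nat f"
  shows "ptime D e enc_nat (\<lambda>x. Suc (f x))"
proof -
  have L: "ptime D e (\<lambda>_::unit. Leaf) (\<lambda>_. ())" by (rule ptime_Leaf) simp
  show ?thesis by (rule ptime_Node[OF L assms]) simp
qed

text \<open>The encoded list can itself serve as the guard of \<open>Cond\<close>; the branches only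
  replace it by the canonical truth value.\<close>

lemma ptime_nonempty:
  assumes "ptime D e (enc_list e') f"
  shows "ptime D e enc_bool (\<lambda>x. f x \<noteq> [])"
proof -
  have "ptime UNIV (enc_list e') enc_bool (\<lambda>l. l \<noteq> [])"
  proof (rule ptimeI)
    let ?t = "\<lambda>l. charge (enc_list e' l) (enc_list e' l) + (if l = [] then charge Leaf Leaf else
      charge (enc_list e' l) Leaf + charge (enc_list e' l) Leaf + charge (enc_list e' l) (Node Leaf Leaf))
      + charge (enc_list e' l) (enc_bool (l \<noteq> []))"
    show "exec (Cond Ident (Join ConstLeaf ConstLeaf) ConstLeaf) (enc_list e' l) (enc_bool (l \<noteq> [])) (?t l)" for l
    proof (cases l)
      case Nil
      show ?thesis unfolding Nil
        using exec.CondFalse[OF exec.Ident exec.ConstLeaf] by simp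
    next
      case (Cons a l')
      then show ?thesis
        using exec.CondTrue[OF exec.Ident _ exec.Join[OF exec.ConstLeaf exec.ConstLeaf], of "enc_list e' l"] by simp
    qed
    show "pbound UNIV (enc_list e') ?t"
    proof (rule pbound_mono)
      show "pbound UNIV (enc_list e') (\<lambda>l. 10 + 10 * size (enc_list e' l))" by (intro pbound_intros)
      show "?t l \<le> 10 + 10 * size (enc_list e' l)" for l
        by (auto simp: charge_def)
    qed
  qed
  from ptime_comp[OF assms this] show ?thesis by simp
qed

section \<open>Folding over lists, the only loop of the calculus\<close>

lemma ex_exec_le: "exec p x y w \<Longrightarrow> w \<le> B \<Longrightarrow> \<exists>w\<le>B. exec p x y w"
  by blast

text \<open>The loop state is \<open>Node x (Node l a)\<close> with fixed parameter x, remaining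
  list l and accumulator a. One round passes x, the head of l and a to q, and keeps x and the
  tail.\<close>

definition fold_body :: "prog \<Rightarrow> prog" where
  "fold_body q = Join LeftSub (Join (Seq RightSub (Seq LeftSub RightSub))
     (Seq (Join LeftSub (Join (Seq RightSub (Seq LeftSub LeftSub)) (Seq RightSub RightSub))) q))"

text \<open>M bounds the sizes and N the step times over all prefixes of the list, so every round
  obeys the same bound. The factor 100 is slack for the constantly many projections and joins of one
  round.\<close>

lemma exec_fold_loop:
  fixes st :: "'a \<Rightarrow> 'b \<Rightarrow> 'c \<Rightarrow> 'c"
  assumes step: "\<And>y a. y \<in> set l \<Longrightarrow> exec q (Node (e x) (Node (e1 y) (e2 a))) (e2 (st x y a)) (U (x, y, a))"
    and M: "\<And>j. size (e x) + size (enc_list e1 l) + size (e2 (foldl (\<lambda>a y. st x y a) a (take j l))) \<le> M"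
    and N: "\<And>j y. y \<in> set l \<Longrightarrow> U (x, y, foldl (\<lambda>a y. st x y a) a (take j l)) \<le> N"
  shows "\<exists>w \<le> (length l + 1) * (N + 100 * (M + 1)).
    exec (Loop (Seq RightSub LeftSub) (fold_body q)) (Node (e x) (Node (enc_list e1 l) (e2 a)))
      (Node (e x) (Node Leaf (e2 (foldl (\<lambda>a y. st x y a) a l)))) w"
  using step M N
proof (induction l arbitrary: a)
  case Nil
  let ?z = "Node (e x) (Node Leaf (e2 a))"
  have "exec (Seq RightSub LeftSub) ?z Leaf (charge ?z (Node Leaf (e2 a)) + charge (Node Leaf (e2 a)) Leaf + charge ?z Leaf)"
    using exec.Seq[OF exec.RightSub exec.LeftSub, of ?z] by simp
  from exec.LoopExit[OF this, of "fold_body q"] show ?case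
    unfolding enc_list.simps foldl.simps
    by (rule ex_exec_le) (use Nil(2)[of 0] in \<open>simp add: charge_def\<close>)
next
  case (Cons y l)
  let ?l = "enc_list e1 l" let ?x = "e x" let ?y = "e1 y" let ?a = "e2 a" let ?a' = "e2 (st x y a)"
  let ?z = "Node ?x (Node (Node ?y ?l) ?a)"
  have sM: "size ?x + size ?y + size ?l + size ?a + 1 \<le> M"
    using Cons.prems(2)[of 0] by simp
  have sM': "size ?x + size ?y + size ?l + size ?a' + 1 \<le> M"
    using Cons.prems(2)[of 1] by simp
  have N: "U (x, y, a) \<le> N" using Cons.prems(3)[of y 0] by simp
  have 1: "exec (Seq RightSub LeftSub) ?z (Node ?y ?l)
    (charge ?z (Node (Node ?y ?l) ?a) + charge (Node (Node ?y ?l) ?a) (Node ?y ?l) + charge ?z (Node ?y ?l))"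
    using exec.Seq[OF exec.RightSub exec.LeftSub, of ?z] by simp
  have 2: "exec (Seq RightSub (Seq LeftSub RightSub)) ?z ?l
    (charge ?z (Node (Node ?y ?l) ?a) + (charge (Node (Node ?y ?l) ?a) (Node ?y ?l) + charge (Node ?y ?l) ?l + charge (Node (Node ?y ?l) ?a) ?l) + charge ?z ?l)"
    using exec.Seq[OF exec.RightSub exec.Seq[OF exec.LeftSub exec.RightSub], of ?z] by simp
  have 3: "exec (Seq RightSub (Seq LeftSub LeftSub)) ?z ?y
    (charge ?z (Node (Node ?y ?l) ?a) + (charge (Node (Node ?y ?l) ?a) (Node ?y ?l) + charge (Node ?y ?l) ?y + charge (Node (Node ?y ?l) ?a) ?y) + charge ?z ?y)"
    using exec.Seq[OF exec.RightSub exec.Seq[OF exec.LeftSub exec.LeftSub], of ?z] by simp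
  have 4: "exec (Seq RightSub RightSub) ?z ?a
    (charge ?z (Node (Node ?y ?l) ?a) + charge (Node (Node ?y ?l) ?a) ?a + charge ?z ?a)"
    using exec.Seq[OF exec.RightSub exec.RightSub, of ?z] by simp
  have 5: "exec LeftSub ?z ?x (charge ?z ?x)"
    using exec.LeftSub[of ?z] by simp
  have 6: "exec q (Node ?x (Node ?y ?a)) ?a' (U (x, y, a))"
    using Cons.prems(1)[of y a] by simp
  note body = exec.Join[OF 5 exec.Join[OF 2 exec.Seq[OF exec.Join[OF 5 exec.Join[OF 3 4]] 6]], folded fold_body_def]
  have "\<exists>w \<le> (length l + 1) * (N + 100 * (M + 1)).
    exec (Loop (Seq RightSub LeftSub) (fold_body q)) (Node ?x (Node ?l ?a'))
      (Node ?x (Node Leaf (e2 (foldl (\<lambda>a y. st x y a) (st x y a) l)))) w"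
  proof (rule Cons.IH)
    fix j show "size ?x + size ?l + size (e2 (foldl (\<lambda>a y. st x y a) (st x y a) (take j l))) \<le> M"
      using Cons.prems(2)[of "Suc j"] by simp
    fix y' assume "y' \<in> set l"
    then show "U (x, y', foldl (\<lambda>a y. st x y a) (st x y a) (take j l)) \<le> N"
      using Cons.prems(3)[of y' "Suc j"] by simp
  qed (use Cons.prems(1) in auto)
  then obtain w where w: "w \<le> (length l + 1) * (N + 100 * (M + 1))"
    and ex: "exec (Loop (Seq RightSub LeftSub) (fold_body q)) (Node ?x (Node ?l ?a'))
      (Node ?x (Node Leaf (e2 (foldl (\<lambda>a y. st x y a) (st x y a) l)))) w"
    by blast
  have fin: "size ?x + size (e2 (foldl (\<lambda>a y. st x y a) (st x y a) l)) \<le> M"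
    using Cons.prems(2)[of "Suc (length l)"] by simp
  have "Node ?y ?l \<noteq> Leaf" by simp
  from exec.LoopStep[OF 1 this body ex] show ?case
    unfolding enc_list.simps foldl.simps
  proof (rule ex_exec_le, goal_cases)
    case 1
    define B where "B = N + 100 * (M + 1)"
    have "(length (y # l) + 1) * B = (length l + 1) * B + B" by simp
    then show ?case unfolding B_def[symmetric] using sM sM' N w[folded B_def] fin
      by (simp only: charge_def tree.size) (simp add: B_def)
  qed
qed

lemma pbound_power: "pbound D e h \<Longrightarrow> pbound D e (\<lambda>x. h x ^ k)"
  by (induction k) (auto intro: pbound_intros)

lemma size_elem_enc_list: "y \<in> set l \<Longrightarrow> size (e y) < size (enc_list e l)"
  by (induction l) auto

lemma length_le_size_enc_list: "length l \<le> size (enc_list e l)"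
  by (induction l) auto

text \<open>A bound B on all intermediate accumulators has to be supplied: a step that runs in
  polynomial time may still square its accumulator, and iterating it would leave the
  polynomials.\<close>

lemma ptime_fold:
  assumes l: "ptime D e (enc_list e1) l" and i: "ptime D e e2 i"
    and st: "ptime (D \<times> UNIV) (enc_pair e (enc_pair e1 e2)) e2 (\<lambda>z. st (fst z) (snd (snd z)) (fst (snd z)))"
    and B: "pbound D e B"
    and le: "\<And>x j. x \<in> D \<Longrightarrow> size (e2 (foldl (st x) (i x) (take j (l x)))) \<le> B x"
  shows "ptime D e e2 (\<lambda>x. foldl (st x) (i x) (l x))"
proof -
  obtain pl Tl where pl: "\<And>x. x \<in> D \<Longrightarrow> exec pl (e x) (enc_list e1 (l x)) (Tl x)" and Tl: "pbound D e Tl"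
    and sl: "pbound D e (\<lambda>x. size (enc_list e1 (l x)))"
    using ptime_exec[OF l] by blast
  obtain pi Ti where pi: "\<And>x. x \<in> D \<Longrightarrow> exec pi (e x) (e2 (i x)) (Ti x)" and Ti: "pbound D e Ti"
    using ptime_exec[OF i] by blast
  obtain q U where q: "\<And>z. z \<in> D \<times> UNIV \<Longrightarrow> exec q (enc_pair e (enc_pair e1 e2) z)
       (e2 (st (fst z) (snd (snd z)) (fst (snd z)))) (U z)"
    and U: "pbound (D \<times> UNIV) (enc_pair e (enc_pair e1 e2)) U"
    using ptime_exec[OF st] by blast
  obtain k where k: "\<And>z. z \<in> D \<times> UNIV \<Longrightarrow> U z \<le> (size (enc_pair e (enc_pair e1 e2) z) + 2) ^ k"
    using U unfolding pbound_def by blast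
  define M where "M = (\<lambda>x. size (e x) + size (enc_list e1 (l x)) + B x)"
  \<comment> \<open>The 4 pays for the two pair nodes of the argument of q and for the 2 in the base
    of the bound on U.\<close>
  define N where "N = (\<lambda>x. (M x + 4) ^ k)"
  define W where "W = (\<lambda>x. (size (enc_list e1 (l x)) + 1) * (N x + 100 * (M x + 1)))"
  have M: "pbound D e M" unfolding M_def by (intro pbound_intros sl B)
  have N: "pbound D e N" unfolding N_def by (intro pbound_intros pbound_power M)
  have W: "pbound D e W" unfolding W_def by (intro pbound_intros sl M N)
  have ex: "\<exists>w\<le>W x. exec (Loop (Seq RightSub LeftSub) (fold_body q)) (Node (e x) (Node (enc_list e1 (l x)) (e2 (i x))))
      (Node (e x) (Node Leaf (e2 (foldl (st x) (i x) (l x))))) w" if x: "x \<in> D" for x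
  proof -
    have "\<exists>w \<le> (length (l x) + 1) * (N x + 100 * (M x + 1)).
      exec (Loop (Seq RightSub LeftSub) (fold_body q)) (Node (e x) (Node (enc_list e1 (l x)) (e2 (i x))))
      (Node (e x) (Node Leaf (e2 (foldl (\<lambda>a y. st x a y) (i x) (l x))))) w"
    proof (rule exec_fold_loop)
      show "exec q (Node (e x) (Node (e1 y) (e2 a))) (e2 (st x a y)) (U (x, y, a))" for y a
        using q[of "(x, y, a)"] x by simp
      show "size (e x) + size (enc_list e1 (l x)) + size (e2 (foldl (\<lambda>a y. st x a y) (i x) (take j (l x)))) \<le> M x" for j
        using le[OF x, of j] by (simp add: M_def)
      show "U (x, y, foldl (\<lambda>a y. st x a y) (i x) (take j (l x))) \<le> N x" if "y \<in> set (l x)" for j y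
      proof -
        let ?z = "(x, y, foldl (\<lambda>a y. st x a y) (i x) (take j (l x)))"
        have "size (enc_pair e (enc_pair e1 e2) ?z) + 2 \<le> M x + 4"
          using size_elem_enc_list[OF that, of e1] le[OF x, of j] by (simp add: M_def)
        then have "(size (enc_pair e (enc_pair e1 e2) ?z) + 2) ^ k \<le> N x"
          unfolding N_def by (rule power_mono) simp
        moreover have "?z \<in> D \<times> UNIV" using x by simp
        ultimately show ?thesis using k by (meson order_trans)
      qed
    qed
    moreover have "(length (l x) + 1) * (N x + 100 * (M x + 1)) \<le> W x"
      unfolding W_def using length_le_size_enc_list[of "l x" e1] by (intro mult_right_mono) auto
    ultimately show ?thesis by (meson order_trans)
  qed
  then obtain w where w: "\<And>x. x \<in> D \<Longrightarrow> w x \<le> W x"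
    and ew: "\<And>x. x \<in> D \<Longrightarrow> exec (Loop (Seq RightSub LeftSub) (fold_body q)) (Node (e x) (Node (enc_list e1 (l x)) (e2 (i x))))
      (Node (e x) (Node Leaf (e2 (foldl (st x) (i x) (l x))))) (w x)"
    by metis
  define a where "a = (\<lambda>x. e2 (foldl (st x) (i x) (l x)))"
  let ?u = "\<lambda>x. Node (e x) (Node (enc_list e1 (l x)) (e2 (i x)))"
  let ?v = "\<lambda>x. Node (e x) (Node Leaf (a x))"
  have ew': "exec (Loop (Seq RightSub LeftSub) (fold_body q)) (?u x) (?v x) (w x)" if "x \<in> D" for x
    using ew[OF that] by (simp add: a_def)
  have init: "exec (Join Ident (Join pl pi)) (e x) (?u x)
      (charge (e x) (e x) + (Tl x + Ti x + charge (e x) (Node (enc_list e1 (l x)) (e2 (i x)))) + charge (e x) (?u x))"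
    if "x \<in> D" for x
    by (intro exec.Join exec.Ident pl pi that)
  have out: "exec (Seq RightSub RightSub) (?v x) (a x)
      (charge (?v x) (Node Leaf (a x)) + charge (Node Leaf (a x)) (a x) + charge (?v x) (a x))" for x
    using exec.Seq[OF exec.RightSub exec.RightSub, of "?v x"] by simp
  have all: "exec (Seq (Join Ident (Join pl pi)) (Seq (Loop (Seq RightSub LeftSub) (fold_body q)) (Seq RightSub RightSub)))
      (e x) (a x) (charge (e x) (e x) + (Tl x + Ti x + charge (e x) (Node (enc_list e1 (l x)) (e2 (i x)))) + charge (e x) (?u x)
       + (w x + (charge (?v x) (Node Leaf (a x)) + charge (Node Leaf (a x)) (a x) + charge (?v x) (a x)) + charge (?u x) (a x))
       + charge (e x) (a x))" (is "exec _ _ _ (?t x)") if "x \<in> D" for x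
    using exec.Seq[OF init[OF that] exec.Seq[OF ew'[OF that] out]] .
  have "pbound D e ?t"
  proof (rule pbound_mono)
    show "pbound D e (\<lambda>x. 50 * (size (e x) + size (enc_list e1 (l x)) + size (e2 (i x)) + B x + Tl x + Ti x + W x + 1))"
      by (intro pbound_intros sl ptime_size i B Tl Ti W)
    show "?t x \<le> 50 * (size (e x) + size (enc_list e1 (l x)) + size (e2 (i x)) + B x + Tl x + Ti x + W x + 1)"
      if "x \<in> D" for x
    proof -
      have "size (a x) \<le> B x" using le[OF that, of "length (l x)"] by (simp add: a_def)
      then show ?thesis using w[OF that] by (simp add: charge_def)
    qed
  qed
  with all show ?thesis unfolding a_def by (rule ptimeI)
qed

text \<open>A filtered map in the shape of a fold, so that \<open>ptime_fold\<close> applies. It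
  reverses the list, which is harmless because nothing later depends on the order of
  entries.\<close>

definition collect :: "('a \<Rightarrow> bool) \<Rightarrow> ('a \<Rightarrow> 'b) \<Rightarrow> 'a list \<Rightarrow> 'b list \<Rightarrow> 'b list" where
  "collect P g xs ys = foldl (\<lambda>acc x. if P x then g x # acc else acc) ys xs"

lemma collect_eq: "collect P g xs ys = rev (map g (filter P xs)) @ ys"
  unfolding collect_def by (induction xs arbitrary: ys) auto

lemma set_collect: "set (collect P g xs ys) = g ` {x \<in> set xs. P x} \<union> set ys"
  by (auto simp: collect_eq)

lemma length_collect: "length (collect P g xs ys) \<le> length xs + length ys"
  by (simp add: collect_eq)

lemma size_enc_list_collect:
  "(\<And>x. x \<in> set xs \<Longrightarrow> size (e (g x)) \<le> m) \<Longrightarrow>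
    size (enc_list e (collect P g xs ys)) \<le> size (enc_list e ys) + length xs * (m + 1)"
  unfolding collect_def
proof (induction xs arbitrary: ys)
  case (Cons x xs)
  let ?ys = "if P x then g x # ys else ys"
  have "size (enc_list e ?ys) \<le> size (enc_list e ys) + (m + 1)"
    using Cons.prems[of x] by simp
  then show ?case using Cons.IH[of ?ys] Cons.prems by simp
qed simp

lemma ptime_collect:
  assumes P: "ptime (D \<times> UNIV) (enc_pair e e1) enc_bool (\<lambda>z. P (fst z) (snd z))"
    and g: "ptime (D \<times> UNIV) (enc_pair e e1) e2 (\<lambda>z. g (fst z) (snd z))"
    and l: "ptime D e (enc_list e1) l" and i: "ptime D e (enc_list e2) i"
  shows "ptime D e (enc_list e2) (\<lambda>x. collect (P x) (g x) (l x) (i x))"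
  unfolding collect_def
proof -
  obtain k where k: "\<And>z. z \<in> D \<times> UNIV \<Longrightarrow> size (e2 (g (fst z) (snd z))) \<le> (size (enc_pair e e1 z) + 2) ^ k"
    using ptime_size[OF g] unfolding pbound_def by blast
  let ?L = "\<lambda>x. size (enc_list e1 (l x))"
  define m where "m = (\<lambda>x. (size (e x) + ?L x + 3) ^ k)"
  have m: "pbound D e m" unfolding m_def by (intro pbound_intros pbound_power ptime_size l)
  show "ptime D e (enc_list e2) (\<lambda>x. foldl (\<lambda>acc y. if P x y then g x y # acc else acc) (i x) (l x))"
  proof (rule ptime_fold[OF l i])
    let ?e = "enc_pair e (enc_pair e1 (enc_list e2))" let ?D = "D \<times> (UNIV :: ('b \<times> 'c list) set)"
    have id: "ptime ?D ?e ?e (\<lambda>z. z)" by (rule ptime_id)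
    have arg: "ptime ?D ?e (enc_pair e e1) (\<lambda>z. (fst z, fst (snd z)))"
      by (rule ptime_Pair[OF ptime_fst[OF id] ptime_fst[OF ptime_snd[OF id]]])
    have P': "ptime ?D ?e enc_bool (\<lambda>z. P (fst z) (fst (snd z)))"
      using ptime_comp[OF arg P] by (simp add: mem_Times_iff)
    have g': "ptime ?D ?e e2 (\<lambda>z. g (fst z) (fst (snd z)))"
      using ptime_comp[OF arg g] by (simp add: mem_Times_iff)
    show "ptime ?D ?e (enc_list e2)
     (\<lambda>z. if P (fst z) (fst (snd z)) then g (fst z) (fst (snd z)) # snd (snd z) else snd (snd z))"
      by (rule ptime_if[OF P' ptime_Cons[OF g' ptime_snd[OF ptime_snd[OF id]]] ptime_snd[OF ptime_snd[OF id]]])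
    show "pbound D e (\<lambda>x. size (enc_list e2 (i x)) + ?L x * (m x + 1))"
      by (intro pbound_intros ptime_size i l m)
    fix x j assume x: "x \<in> D"
    have "size (e2 (g x y)) \<le> m x" if "y \<in> set (take j (l x))" for y
    proof -
      have "y \<in> set (l x)" using that by (rule in_set_takeD)
      then have "size (enc_pair e e1 (x, y)) + 2 \<le> size (e x) + ?L x + 3"
        using size_elem_enc_list[of y "l x" e1] by simp
      then have "(size (enc_pair e e1 (x, y)) + 2) ^ k \<le> m x"
        unfolding m_def by (rule power_mono) simp
      then show ?thesis using k[of "(x, y)"] x by simp
    qed
    then have "size (enc_list e2 (collect (P x) (g x) (take j (l x)) (i x)))
        \<le> size (enc_list e2 (i x)) + length (take j (l x)) * (m x + 1)"
      by (rule size_enc_list_collect)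
    also have "\<dots> \<le> size (enc_list e2 (i x)) + ?L x * (m x + 1)"
      using length_le_size_enc_list[of "l x" e1] by (intro add_left_mono mult_right_mono) auto
    finally show "size (enc_list e2 (foldl (\<lambda>acc y. if P x y then g x y # acc else acc) (i x) (take j (l x))))
      \<le> size (enc_list e2 (i x)) + ?L x * (m x + 1)" by (simp add: collect_def)
  qed
qed

text \<open>The search collects one unit for each hit and then tests whether anything was
  collected.\<close>

lemma ptime_bex:
  assumes P: "ptime (D \<times> UNIV) (enc_pair e e1) enc_bool (\<lambda>z. P (fst z) (snd z))"
    and l: "ptime D e (enc_list e1) l"
  shows "ptime D e enc_bool (\<lambda>x. \<exists>y\<in>set (l x). P x y)"
proof -
  have "ptime (D \<times> UNIV) (enc_pair e e1) (\<lambda>_::unit. Leaf) (\<lambda>z. ())"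
    by (rule ptime_Leaf) simp
  from ptime_nonempty[OF ptime_collect[OF P this l ptime_Nil]]
  show ?thesis by (rule ptime_recode) (auto simp: collect_eq filter_empty_conv)
qed

section \<open>Unary arithmetic\<close>

lemma enc_nat_eq_replicate: "enc_nat k = enc_list (\<lambda>_. Leaf) (replicate k ())"
  by (induction k) auto

lemma size_enc_nat: "size (enc_nat k) = k"
  by (induction k) auto

lemma inj_enc_nat: "inj enc_nat"
  by (rule injI) (metis size_enc_nat)

text \<open>A unary number has the encoding of a list of units, so subtraction is a fold of
  predecessors over the subtrahend. Comparisons reduce to a difference being zero.\<close>

lemma ptime_minus:
  assumes f: "ptime D e enc_nat f" and g: "ptime D e enc_nat g"
  shows "ptime D e enc_nat (\<lambda>x. f x - g x)"
proof -
  have g': "ptime D e (enc_list (\<lambda>_. Leaf)) (\<lambda>x. replicate (g x) ())"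
    using g by (rule ptime_recode) (rule enc_nat_eq_replicate)
  have eq: "foldl (\<lambda>a _. a - Suc 0) k us = k - length us" for k :: nat and us :: "unit list"
    by (induction us arbitrary: k) auto
  have "ptime D e enc_nat (\<lambda>x. foldl (\<lambda>a _. a - 1) (f x) (replicate (g x) ()))"
  proof (rule ptime_fold[OF g' f])
    let ?e = "enc_pair e (enc_pair (\<lambda>_::unit. Leaf) enc_nat)"
    have "ptime (D \<times> UNIV) ?e enc_nat (\<lambda>z. snd (snd z))"
      by (rule ptime_snd[OF ptime_snd[OF ptime_id]])
    then show "ptime (D \<times> UNIV) ?e enc_nat (\<lambda>z. snd (snd z) - 1)"
    proof (rule ptime_right)
      show "enc_nat (snd (snd z) - 1) = right_sub (enc_nat (snd (snd z)))" for z :: "'a \<times> unit \<times> nat"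
        by (cases "snd (snd z)") auto
    qed
    show "pbound D e (\<lambda>x. size (enc_nat (f x)))" by (rule ptime_size[OF f])
  qed (simp add: eq size_enc_nat)
  then show ?thesis by (rule ptime_recode) (simp add: eq)
qed

lemma ptime_less:
  assumes "ptime D e enc_nat f" "ptime D e enc_nat g"
  shows "ptime D e enc_bool (\<lambda>x. f x < g x)"
  using ptime_not[OF ptime_eq[OF ptime_minus[OF assms(2,1)] ptime_0 inj_enc_nat]]
  by (rule ptime_recode) (simp add: linorder_not_le)

lemma ptime_le:
  assumes "ptime D e enc_nat f" "ptime D e enc_nat g"
  shows "ptime D e enc_bool (\<lambda>x. f x \<le> g x)"
  using ptime_eq[OF ptime_minus[OF assms] ptime_0 inj_enc_nat]
  by (rule ptime_recode) simp

section \<open>Labelled rectangulations\<close>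

text \<open>
  \<open>V x g\<close> is the vertical unit edge from \<open>(x, g)\<close> to \<open>(x, g + 1)\<close>, and \<open>H x y\<close> the horizontal one from
  \<open>(x, y)\<close> to \<open>(x + 1, y)\<close>.  Below, \<open>(x, g, f) \<in> K\<close> means that the edge \<open>V x g\<close> carries the label \<open>f\<close>.
\<close>

definition good :: "nat \<Rightarrow> point set \<Rightarrow> (nat \<Rightarrow> nat \<Rightarrow> bool) \<Rightarrow> (nat \<Rightarrow> nat \<Rightarrow> bool) \<Rightarrow> bool" where
  "good n P V H \<longleftrightarrow> (\<forall>x\<in>{1..n}. \<forall>y\<in>{1..n}.
     if (x, y) \<in> P then V x (y - 1) \<and> V x y \<or> H (x - 1) y \<and> H x y
     else (V x (y - 1) \<longleftrightarrow> V x y) \<and> (H (x - 1) y \<longleftrightarrow> H x y) \<and> \<not> (V x y \<and> H x y))"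

lemma good_through:
  assumes "good n P V H" "x \<in> {1..n}" "y \<in> {1..n}" "(x, y) \<notin> P"
    and "g \<in> {y - 1, y}" "g' \<in> {y - 1, y}"
  shows "V x g \<longleftrightarrow> V x g'"
  using assms unfolding good_def by (metis insertE singletonD)

lemma good_straight:
  assumes "good n P V H" "x \<in> {1..n}" "y \<in> {1..n}" "(x, y) \<in> P"
    and "g \<in> {y - 1, y}" "\<not> V x g"
  shows "H (x - 1) y" "H x y"
  using assms unfolding good_def by (metis insertE singletonD)+

lemma good_free:
  assumes "good n P V H" "x \<in> {1..n}" "y \<in> {1..n}" "(x, y) \<notin> P"
  shows "H (x - 1) y \<longleftrightarrow> H x y" "\<not> (V x y \<and> H x y)"
  using assms unfolding good_def by meson+

text \<open>Row y borders the strips y - 1 and y, and g is one of them. Follow the line from column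
  c: a point of P on the way lacks the vertical edge in strip g, so the horizontal line must go
  through it, and outside P lines go straight anyway. At column d the line meets a vertical edge,
  which it may not cross outside P.\<close>

lemma good_next_right:
  assumes good: "good n P V H" and y: "y \<in> {1..n}" and g: "g \<in> {y - 1, y}"
    and c: "1 \<le> c" "c < d" "d \<le> n" and H: "H c y"
    and between: "\<And>j. c < j \<Longrightarrow> j < d \<Longrightarrow> \<not> V j g" and V: "V d g"
  shows "(d, y) \<in> P"
proof (rule ccontr)
  assume nP: "(d, y) \<notin> P"
  have *: "H j y" if "c \<le> j" "j < d" for j
    using that
  proof (induction j rule: dec_induct)
    case base
    show ?case by (rule H)
  next
    case (step j)
    have j: "Suc j \<in> {1..n}" using step c by auto
    show ?case
    proof (cases "(Suc j, y) \<in> P")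
      case True
      then show ?thesis
        using good_straight(2)[OF good j y True g] between[of "Suc j"] step by simp
    next
      case False
      then show ?thesis
        using good_free(1)[OF good j y False] step by simp
    qed
  qed
  have d: "d \<in> {1..n}" using c by auto
  have "V d y" using good_through[OF good d y nP g, of y] V by simp
  moreover have "H (d - 1) y" using *[of "d - 1"] c by simp
  ultimately show False using good_free[OF good d y nP] by blast
qed

lemma good_next_left:
  assumes good: "good n P V H" and y: "y \<in> {1..n}" and g: "g \<in> {y - 1, y}"
    and c: "1 \<le> c" "c < d" "d \<le> n" and H: "H (d - 1) y"
    and between: "\<And>j. c < j \<Longrightarrow> j < d \<Longrightarrow> \<not> V j g" and V: "V c g"
  shows "(c, y) \<in> P"
proof (rule ccontr)
  assume nP: "(c, y) \<notin> P"
  have "c \<le> d - 1" using c by simp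
  then have Hc: "H c y"
  proof (induction rule: inc_induct)
    case base
    show ?case by (rule H)
  next
    case (step j)
    have j: "Suc j \<in> {1..n}" using step c by auto
    show ?case
    proof (cases "(Suc j, y) \<in> P")
      case True
      then show ?thesis
        using good_straight(1)[OF good j y True g] between[of "Suc j"] step by simp
    next
      case False
      then show ?thesis
        using good_free(1)[OF good j y False] step by simp
    qed
  qed
  have d: "c \<in> {1..n}" using c by auto
  have "V c y" using good_through[OF good d y nP g, of y] V by simp
  then show False using Hc good_free[OF good d y nP] by blast
qed

section \<open>The invariant, and its preservation when segments are removed\<close>

definition alive :: "(nat \<times> nat \<times> nat) set \<Rightarrow> nat \<Rightarrow> nat \<Rightarrow> bool" where
  "alive K f g \<longleftrightarrow> (\<exists>x. (x, g, f) \<in> K)"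

lemma aliveI: "(x, g, f) \<in> K \<Longrightarrow> alive K f g"
  by (auto simp: alive_def)

lemma alive_between:
  assumes cross: "\<And>x y. lo < y \<Longrightarrow> y < hi \<Longrightarrow> (x, y - 1, f) \<in> K \<longleftrightarrow> (x, y, f) \<in> K"
    and g: "g \<in> {lo..<hi}" "g' \<in> {lo..<hi}"
  shows "alive K f g \<longleftrightarrow> alive K f g'"
proof -
  have *: "alive K f g \<longleftrightarrow> alive K f lo" if "lo \<le> g" "g < hi" for g
    using that
  proof (induction g rule: dec_induct)
    case (step k)
    have "alive K f (Suc k) \<longleftrightarrow> alive K f k"
      unfolding alive_def using cross[of "Suc k"] step by auto
    then show ?case using step by simp
  qed simp
  show ?thesis using *[of g] *[of g'] g by simp
qed

text \<open>K holds the current labels, Y the points produced so far. \<open>pairs\<close> is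
  satisfaction in a form that survives the run: it ranges over all pairs of positions, including
  those not yet in Y. If the box has no witness, then either both labels are present in all strips
  between the two rows, or one of the positions is outside Y and its label is gone from both
  adjacent strips. Since labels are only copied within a strip, such a position can never enter Y
  later. Once no label is left, two points of Y in different rows and columns are left with the
  witness.\<close>

locale labelling =
  fixes n :: nat and P :: "point set" and V H :: "nat \<Rightarrow> nat \<Rightarrow> bool"
    and K :: "(nat \<times> nat \<times> nat) set" and Y :: "point set"
  assumes good: "good n P V H"
    and range: "(x, g, f) \<in> K \<Longrightarrow> x \<in> {1..n} \<and> f \<in> {1..n} \<and> V x g"
    and functional: "(x, g, f) \<in> K \<Longrightarrow> (x, g, f') \<in> K \<Longrightarrow> f = f'"
    and complete: "(x, g, f) \<in> K \<Longrightarrow> x < x' \<Longrightarrow> x' \<le> n \<Longrightarrow> V x' g \<Longrightarrow> \<exists>f'. (x', g, f') \<in> K"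
    and sorted: "(x, g, f) \<in> K \<Longrightarrow> (x', g, f') \<in> K \<Longrightarrow> x < x' \<Longrightarrow> f \<le> f'"
    and cross: "(f, y) \<notin> Y \<Longrightarrow> y \<in> {1..n} \<Longrightarrow> (x, y - 1, f) \<in> K \<longleftrightarrow> (x, y, f) \<in> K"
    and cross_free: "(f, y) \<notin> Y \<Longrightarrow> y \<in> {1..n} \<Longrightarrow> (x, y, f) \<in> K \<Longrightarrow> (x, y) \<notin> P"
    and touch: "(f, y) \<in> Y \<Longrightarrow> g \<in> {y - 1, y} \<Longrightarrow> alive K f g \<Longrightarrow> \<exists>x. (x, g, f) \<in> K \<and> (x, y) \<in> P"
    and Y_grid: "Y \<subseteq> {1..n} \<times> {1..n}"
    and pairs: "\<lbrakk>x1 < x2; y1 \<noteq> y2; y1 \<in> {1..n}; y2 \<in> {1..n}\<rbrakk> \<Longrightarrow>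
       (\<exists>z\<in>Y. z \<in> box (x1, y1) (x2, y2) \<and> z \<noteq> (x1, y1) \<and> z \<noteq> (x2, y2)) \<or>
       (\<forall>g\<in>{min y1 y2..<max y1 y2}. alive K x1 g \<and> alive K x2 g) \<or>
       ((x1, y1) \<notin> Y \<and> (\<forall>g\<in>{y1 - 1, y1}. \<not> alive K x1 g)) \<or>
       ((x2, y2) \<notin> Y \<and> (\<forall>g\<in>{y2 - 1, y2}. \<not> alive K x2 g))"
begin

lemma cross_gaps:
  assumes "(f, y) \<notin> Y" "y \<in> {1..n}" "g \<in> {y - 1, y}" "g' \<in> {y - 1, y}" "(x, g, f) \<in> K"
  shows "(x, g', f) \<in> K" "(x, y) \<notin> P"
  using assms cross[OF assms(1,2), of x] cross_free[OF assms(1,2), of x] by auto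

lemma sorted_le: "f \<le> f'" if "(x, g, f) \<in> K" "(x', g, f') \<in> K" "x \<le> x'"
  using that functional[of x g f f'] sorted[of x g f x' f'] by (cases "x = x'") auto

lemma label_less: "x < x'" if "(x, g, f) \<in> K" "(x', g, f') \<in> K" "f < f'"
  using sorted_le[OF that(2,1)] that(3) by linarith

lemma satisfied_if_no_vertical:
  assumes "\<And>x g. \<not> V x g"
  shows "satisfied Y"
proof -
  have dead: "\<not> alive K f g" for f g using range assms by (auto simp: alive_def)
  have *: "\<exists>z\<in>Y. z \<in> box a b \<and> z \<noteq> a \<and> z \<noteq> b"
    if ab: "a \<in> Y" "b \<in> Y" "fst a < fst b" "snd a \<noteq> snd b" for a b
  proof -
    obtain x1 y1 x2 y2 where [simp]: "a = (x1, y1)" "b = (x2, y2)" by (cases a, cases b) auto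
    have "y1 \<in> {1..n}" "y2 \<in> {1..n}" using Y_grid ab by auto
    moreover have "{min y1 y2..<max y1 y2} \<noteq> {}" using ab by auto
    ultimately show ?thesis using pairs[of x1 x2 y1 y2] ab dead by auto
  qed
  have box_commute: "box a b = box b a" for a b by (auto simp: box_def)
  show ?thesis
    unfolding satisfied_def
  proof (intro ballI)
    fix a b assume ab: "a \<in> Y" "b \<in> Y"
    show "fst a = fst b \<or> snd a = snd b \<or> box a b \<inter> (Y - {a, b}) \<noteq> {}"
    proof (cases "fst a = fst b \<or> snd a = snd b")
      case False
      then have "\<exists>z\<in>Y. z \<in> box a b \<and> z \<noteq> a \<and> z \<noteq> b"
        using *[OF ab] *[OF ab(2,1), unfolded box_commute[of b a]] by (metis linorder_neqE_nat)
      then show ?thesis by blast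
    qed blast
  qed
qed

text \<open>To the right of a labelled edge every edge of the strip is labelled, by
  \<open>complete\<close>. So the nearest labelled edge is the nearest vertical edge of any kind, as
  \<open>good_next_right\<close> requires.\<close>

lemma next_label_right:
  assumes K: "(c, g, f) \<in> K" "(e, g, h) \<in> K" and lt: "f < h"
  obtains d f' where "c < d" "(d, g, f') \<in> K" "f \<le> f'" "f' \<le> h" "\<And>j. c < j \<Longrightarrow> j < d \<Longrightarrow> \<not> V j g"
proof -
  have "c < e" using label_less[OF K lt] .
  define d where "d = (LEAST d. c < d \<and> (\<exists>f'. (d, g, f') \<in> K))"
  have "c < d \<and> (\<exists>f'. (d, g, f') \<in> K)"
    unfolding d_def using \<open>c < e\<close> K by (intro LeastI) blast
  then obtain f' where d: "c < d" "(d, g, f') \<in> K" by blast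
  have "d \<le> e" unfolding d_def using \<open>c < e\<close> K by (intro Least_le) blast
  then have "f' \<le> h" using sorted_le[OF d(2) K(2)] by simp
  moreover have "\<not> V j g" if j: "c < j" "j < d" for j
  proof
    assume "V j g"
    moreover have "j \<le> n" using that d range by fastforce
    ultimately obtain f'' where "(j, g, f'') \<in> K" using complete[OF K(1), of j] j by blast
    then have "d \<le> j" unfolding d_def using that by (intro Least_le) blast
    then show False using that by simp
  qed
  ultimately show ?thesis using that d sorted[OF K(1) d(2,1)] by blast
qed

lemma next_label_left:
  assumes K: "(c, g, f) \<in> K" "(e, g, h) \<in> K" and lt: "h < f"
  obtains d f' where "d < c" "(d, g, f') \<in> K" "h \<le> f'" "f' \<le> f" "\<And>j. d < j \<Longrightarrow> j < c \<Longrightarrow> \<not> V j g"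
proof -
  have "e < c" using label_less[OF K(2,1) lt] .
  let ?D = "{d. d < c \<and> (\<exists>f'. (d, g, f') \<in> K)}"
  define d where "d = Max ?D"
  have fin: "finite ?D" by simp
  have "d \<in> ?D"
    unfolding d_def using \<open>e < c\<close> K by (intro Max_in) auto
  then obtain f' where d: "d < c" "(d, g, f') \<in> K" by blast
  have "e \<le> d" unfolding d_def using \<open>e < c\<close> K by (intro Max_ge) auto
  then have "h \<le> f'" using sorted_le[OF K(2) d(2)] by simp
  moreover have "\<not> V j g" if j: "d < j" "j < c" for j
  proof
    assume "V j g"
    moreover have "j \<le> n" using that K range by fastforce
    ultimately obtain f'' where "(j, g, f'') \<in> K" using complete[OF d(2), of j] j by blast
    then have "j \<le> d" unfolding d_def using that by (intro Max_ge) auto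
    then show False using that by simp
  qed
  ultimately show ?thesis using that d sorted[OF d(2) K(1) d(1)] by blast
qed

text \<open>Y stays fixed, and the work lies in \<open>touch\<close> and \<open>pairs\<close>. A
  whole batch of segments disappears at once, possibly with both labels of a pair, and no valid
  state in between is available. The argument for \<open>pairs\<close> therefore takes a horizontal
  line that exists after the removal and follows it among the vertical edges present before
  it.\<close>

lemma removal:
  assumes good': "good n P V' H'" and V': "\<And>x g. V' x g \<Longrightarrow> V x g" and H': "\<And>x y. H' x y \<Longrightarrow> H x y"
  shows "labelling n P V' H' {(x, g, f) \<in> K. V' x g} Y"
proof -
  define K' where "K' = {(x, g, f) \<in> K. V' x g}"
  have sub [simp]: "(x, g, f) \<in> K' \<longleftrightarrow> (x, g, f) \<in> K \<and> V' x g" for x g f by (simp add: K'_def)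
  have alive_sub: "alive K' f g \<Longrightarrow> alive K f g" for f g by (auto simp: alive_def)
  have cross': "(x, y - 1, f) \<in> K' \<longleftrightarrow> (x, y, f) \<in> K'" if "(f, y) \<notin> Y" "y \<in> {1..n}" for x y f
    using cross[OF that, of x] cross_free[OF that, of x] range[of x y f]
      good_through[OF good', of x y "y - 1" y] that by auto
  have touch': "\<exists>x. (x, g, f) \<in> K' \<and> (x, y) \<in> P"
    if Y: "(f, y) \<in> Y" and g: "g \<in> {y - 1, y}" and al: "alive K' f g" for f y g
  proof -
    have y: "y \<in> {1..n}" using Y Y_grid by auto
    obtain c where c: "(c, g, f) \<in> K" "(c, y) \<in> P" using touch[OF Y g alive_sub[OF al]] by blast
    have cn: "c \<in> {1..n}" using range[OF c(1)] by simp
    show ?thesis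
    proof (cases "V' c g")
      case False
      \<comment> \<open>The edge at c is gone while (c, y) stays in P, so a horizontal line passes
        through (c, y). Towards a surviving edge e with label f it first meets some surviving edge
        d. Sortedness forces the label of d to be f, and the two meet in a point of P.\<close>
      note H = good_straight[OF good' cn y c(2) g False]
      obtain e where e: "(e, g, f) \<in> K" "V' e g" using al by (auto simp: alive_def)
      have en: "e \<in> {1..n}" using range[OF e(1)] by simp
      consider "c < e" | "e < c" using False e by (metis linorder_neqE_nat)
      then show ?thesis
      proof cases
        case 1
        define d where "d = (LEAST d. c < d \<and> V' d g)"
        have d: "c < d" "V' d g" using LeastI[of "\<lambda>d. c < d \<and> V' d g" e] 1 e by (auto simp: d_def)
        have de: "d \<le> e" unfolding d_def using 1 e by (intro Least_le) auto
        have btw: "\<not> V' j g" if "c < j" "j < d" for j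
          using that not_less_Least[of j "\<lambda>d. c < d \<and> V' d g"] by (auto simp: d_def)
        obtain f' where f': "(d, g, f') \<in> K"
          using complete[OF c(1) d(1)] V'[OF d(2)] de en by auto
        have "f \<le> f'" using sorted[OF c(1) f' d(1)] .
        moreover have "f' \<le> f" using sorted_le[OF f' e(1) de] .
        ultimately have "(d, g, f) \<in> K" using f' by simp
        moreover have "(d, y) \<in> P"
          using good_next_right[where ?V = V' and g = g, OF good' y g _ d(1) _ H(2) btw d(2)] cn de en by auto
        ultimately show ?thesis using d by auto
      next
        case 2
        let ?D = "{d. d < c \<and> V' d g}"
        define d where "d = Max ?D"
        have "finite ?D" by simp
        then have "d \<in> ?D" unfolding d_def using 2 e by (intro Max_in) auto
        then have d: "d < c" "V' d g" by auto
        have de: "e \<le> d" unfolding d_def using 2 e by (intro Max_ge) auto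
        have btw: "\<not> V' j g" if "d < j" "j < c" for j
        proof
          assume "V' j g"
          then have "j \<le> d" unfolding d_def using that by (intro Max_ge) auto
          then show False using that by simp
        qed
        obtain f' where f': "(d, g, f') \<in> K"
          using complete[OF e(1), of d] V'[OF d(2)] de d cn e by (cases "d = e") auto
        have "f' \<le> f" using sorted[OF f' c(1) d(1)] .
        moreover have "f \<le> f'" using sorted_le[OF e(1) f' de] .
        ultimately have "(d, g, f) \<in> K" using f' by simp
        moreover have "(d, y) \<in> P"
          using good_next_left[where ?V = V' and g = g, OF good' y g _ d(1) _ H(1) btw d(2)] cn de en by auto
        ultimately show ?thesis using d by auto
      qed
    qed (use c in auto)
  qed
  have dead': "\<forall>g\<in>{y - 1, y}. \<not> alive K' f g"
    if "(f, y) \<notin> Y" "y \<in> {1..n}" "g0 \<in> {y - 1, y}" "\<not> alive K' f g0" for f y g0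
    using cross'[OF that(1,2)] that(3,4) unfolding alive_def by blast
  have alive_between': "alive K' f g \<longleftrightarrow> alive K' f g'"
    if "\<And>y. lo < y \<Longrightarrow> y < hi \<Longrightarrow> (f, y) \<notin> Y" "hi \<le> n" "g \<in> {lo..<hi}" "g' \<in> {lo..<hi}" for f g g' lo hi
    by (rule alive_between[OF cross' that(3,4)]) (use that(1,2) in auto)
  have pairs': "(\<exists>z\<in>Y. z \<in> box (x1, y1) (x2, y2) \<and> z \<noteq> (x1, y1) \<and> z \<noteq> (x2, y2)) \<or>
       (\<forall>g\<in>{min y1 y2..<max y1 y2}. alive K' x1 g \<and> alive K' x2 g) \<or>
       ((x1, y1) \<notin> Y \<and> (\<forall>g\<in>{y1 - 1, y1}. \<not> alive K' x1 g)) \<or>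
       ((x2, y2) \<notin> Y \<and> (\<forall>g\<in>{y2 - 1, y2}. \<not> alive K' x2 g))"
    (is "?wit \<or> ?both \<or> ?left \<or> ?right")
    if lt: "x1 < x2" and ne: "y1 \<noteq> y2" and y: "y1 \<in> {1..n}" "y2 \<in> {1..n}" for x1 x2 y1 y2
  proof (rule ccontr)
    assume neg: "\<not> (?wit \<or> ?both \<or> ?left \<or> ?right)"
    let ?G = "{min y1 y2..<max y1 y2}"
    have le_n: "max y1 y2 \<le> n" using y by auto
    have nowit: "\<And>z. z \<in> Y \<Longrightarrow> z \<in> box (x1, y1) (x2, y2) \<Longrightarrow> z = (x1, y1) \<or> z = (x2, y2)"
      and notboth: "\<not> ?both" and noleft: "\<not> ?left" and noright: "\<not> ?right"
      using neg by blast+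
    have free: "(f, k) \<notin> Y" if "x1 \<le> f" "f \<le> x2" "min y1 y2 \<le> k" "k \<le> max y1 y2"
      "(f, k) \<noteq> (x1, y1)" "(f, k) \<noteq> (x2, y2)" for f k
      using nowit[of "(f, k)"] that lt by (auto simp: box_def)
    have "\<forall>g\<in>?G. alive K x1 g \<and> alive K x2 g"
      using pairs[OF lt ne y] nowit noleft noright alive_sub by meson
    then have old: "alive K x1 g" "alive K x2 g" if "g \<in> ?G" for g
      using that by blast+
    obtain g where g: "g \<in> ?G" "\<not> alive K' x1 g \<or> \<not> alive K' x2 g" using notboth by blast
    \<comment> \<open>The strip next to row y1 on the side of row y2; g2 is its counterpart at row
      y2.\<close>
    define g1 where "g1 = (if y1 < y2 then y1 else y1 - 1)"
    define g2 where "g2 = (if y1 < y2 then y2 - 1 else y2)"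
    have g1: "g1 \<in> ?G" "g1 \<in> {y1 - 1, y1}" and g2: "g2 \<in> ?G" "g2 \<in> {y2 - 1, y2}"
      using ne by (auto simp: g1_def g2_def)
    from g(2) show False
    proof
      assume "\<not> alive K' x1 g"
      \<comment> \<open>No point of Y with first coordinate x1 lies strictly between the two rows,
        so a loss of x1 in one strip between them is a loss in all of them, in particular next to
        y1.\<close>
      then have dead: "\<not> alive K' x1 g1"
        using alive_between'[OF _ le_n g(1) g1(1), of x1] free[of x1] lt by fastforce
      have Y: "(x1, y1) \<in> Y" using dead'[OF _ y(1) g1(2) dead] noleft by blast
      let ?M = "{c. (c, g1, x1) \<in> K \<and> (c, y1) \<in> P}"
      have "?M \<subseteq> {1..n}" using range by auto
      then have fin: "finite ?M" by (rule finite_subset) simp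
      have ne: "?M \<noteq> {}" using touch[OF Y g1(2) old(1)[OF g1(1)]] by blast
      \<comment> \<open>The rightmost choice: the line from (c, y1) leads to an edge whose label f
        satisfies x1 \<le> f \<le> x2. If f = x1, that edge contradicts maximality. Otherwise a
        point of P lies on an edge labelled f although (f, y1) is outside Y.\<close>
      define c where "c = Max ?M"
      have "c \<in> ?M" unfolding c_def using fin ne by (rule Max_in)
      then have c: "(c, g1, x1) \<in> K" "(c, y1) \<in> P" by auto
      have cn: "c \<in> {1..n}" using range[OF c(1)] by simp
      have "\<not> V' c g1" using dead c(1) by (auto simp: alive_def)
      from good_straight(2)[OF good' cn y(1) c(2) g1(2) this] have Hc: "H c y1" by (rule H')
      obtain e where "(e, g1, x2) \<in> K" using old(2)[OF g1(1)] by (auto simp: alive_def)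
      from next_label_right[OF c(1) this lt] obtain d f where d: "c < d" "(d, g1, f) \<in> K" "x1 \<le> f" "f \<le> x2"
        and btw: "\<And>j. c < j \<Longrightarrow> j < d \<Longrightarrow> \<not> V j g1" by blast
      have dP: "(d, y1) \<in> P"
        using good_next_right[OF good y(1) g1(2) _ d(1) _ Hc btw] cn range[OF d(2)] by auto
      show False
      proof (cases "f = x1")
        case True
        then have "d \<in> ?M" using d dP by simp
        then have "d \<le> c" unfolding c_def using fin by (rule Max_ge[rotated])
        then show False using d by simp
      next
        case False
        then have "(f, y1) \<notin> Y" using free[of f y1] d \<open>y1 \<noteq> y2\<close> by auto
        from cross_gaps(2)[OF this y(1) g1(2) g1(2) d(2)] dP show False by contradiction
      qed
    next
      assume "\<not> alive K' x2 g"
      then have dead: "\<not> alive K' x2 g2"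
        using alive_between'[OF _ le_n g(1) g2(1), of x2] free[of x2] lt by fastforce
      have Y: "(x2, y2) \<in> Y" using dead'[OF _ y(2) g2(2) dead] noright by blast
      let ?M = "{c. (c, g2, x2) \<in> K \<and> (c, y2) \<in> P}"
      have "?M \<subseteq> {1..n}" using range by auto
      then have fin: "finite ?M" by (rule finite_subset) simp
      have ne: "?M \<noteq> {}" using touch[OF Y g2(2) old(2)[OF g2(1)]] by blast
      \<comment> \<open>Mirror image of the previous case: the leftmost choice, with the line
        followed to the left.\<close>
      define c where "c = Min ?M"
      have "c \<in> ?M" unfolding c_def using fin ne by (rule Min_in)
      then have c: "(c, g2, x2) \<in> K" "(c, y2) \<in> P" by auto
      have cn: "c \<in> {1..n}" using range[OF c(1)] by simp
      have "\<not> V' c g2" using dead c(1) by (auto simp: alive_def)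
      from good_straight(1)[OF good' cn y(2) c(2) g2(2) this] have Hc: "H (c - 1) y2" by (rule H')
      obtain e where "(e, g2, x1) \<in> K" using old(1)[OF g2(1)] by (auto simp: alive_def)
      from next_label_left[OF c(1) this lt] obtain d f where d: "d < c" "(d, g2, f) \<in> K" "x1 \<le> f" "f \<le> x2"
        and btw: "\<And>j. d < j \<Longrightarrow> j < c \<Longrightarrow> \<not> V j g2" by blast
      have dP: "(d, y2) \<in> P"
        using good_next_left[OF good y(2) g2(2) _ d(1) _ Hc btw] cn range[OF d(2)] by auto
      show False
      proof (cases "f = x2")
        case True
        then have "d \<in> ?M" using d dP by simp
        then have "c \<le> d" unfolding c_def using fin by (rule Min_le[rotated])
        then show False using d by simp
      next
        case False
        then have "(f, y2) \<notin> Y" using free[of f y2] d \<open>y1 \<noteq> y2\<close> by auto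
        from cross_gaps(2)[OF this y(2) g2(2) g2(2) d(2)] dP show False by contradiction
      qed
    qed
  qed
  show ?thesis
  proof (fold K'_def, unfold_locales, goal_cases)
    case 1 show ?case by (rule good')
  next
    case (2 x g f) then show ?case using range by auto
  next
    case (3 x g f f') then show ?case using functional by auto
  next
    case (4 x g f x') then show ?case using complete[of x g f x'] V' by auto
  next
    case (5 x g f x' f') then show ?case using sorted by auto
  next
    case (6 f y x) then show ?case by (rule cross')
  next
    case (7 f y x) then show ?case using cross_free by auto
  next
    case (8 f y g) then show ?case by (rule touch')
  next
    case 9 show ?case by (rule Y_grid)
  next
    case (10 x1 x2 y1 y2) then show ?case by (rule pairs')
  qed
qed

end

section \<open>Preservation of the invariant by flips\<close>

definition covers_gap :: "point \<Rightarrow> point \<Rightarrow> nat \<Rightarrow> bool" where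
  "covers_gap a b g \<longleftrightarrow> snd a \<le> g \<and> g < snd b \<or> snd b \<le> g \<and> g < snd a"

text \<open>The last condition includes column \<open>fst a\<close> itself, so an edge that already
  has a label receives no second one. Margin columns stay unlabelled: nothing lies to the left of
  column 0, and \<open>fst a \<le> n\<close> excludes column n + 1.\<close>

definition new_labels :: "nat \<Rightarrow> point \<Rightarrow> point \<Rightarrow> (nat \<times> nat \<times> nat) set \<Rightarrow> (nat \<times> nat \<times> nat) set" where
  "new_labels n a b K = {(fst a, g, f) | x g f. fst a = fst b \<and> fst a \<le> n \<and> covers_gap a b g \<and>
     (x, g, f) \<in> K \<and> x < fst a \<and> (\<forall>j f'. (j, g, f') \<in> K \<longrightarrow> x < j \<longrightarrow> \<not> j \<le> fst a)}"

definition touched :: "nat \<Rightarrow> point \<Rightarrow> (nat \<times> nat \<times> nat) set \<Rightarrow> point set" where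
  "touched n p K = {(f, snd p) | g f. (fst p, g, f) \<in> K \<and> 0 < snd p \<and> snd p \<le> n \<and> (snd p = g \<or> snd p = Suc g)}"

lemma touchedD:
  "(f, y) \<in> touched n p K \<Longrightarrow> y = snd p \<and> y \<in> {1..n} \<and> (\<exists>g\<in>{y - 1, y}. (fst p, g, f) \<in> K)"
  unfolding touched_def by fastforce

context labelling
begin

text \<open>By \<open>complete\<close>, the absence of labelled edges between the source and its
  copy means the absence of all vertical edges there; this is what permits tracing horizontal lines
  back to the source.\<close>

lemma new_labelsE:
  assumes "(z, g, f) \<in> new_labels n a b K"
  obtains x where "z = fst a" "fst a = fst b" "fst a \<le> n" "covers_gap a b g" "(x, g, f) \<in> K" "x < z"
    "\<And>j. x < j \<Longrightarrow> j \<le> z \<Longrightarrow> \<not> V j g" "\<And>j f'. x < j \<Longrightarrow> j \<le> z \<Longrightarrow> (j, g, f') \<notin> K"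
proof -
  obtain x where x: "z = fst a" "fst a = fst b" "fst a \<le> n" "covers_gap a b g" "(x, g, f) \<in> K" "x < z"
    and no: "\<And>j f'. x < j \<Longrightarrow> j \<le> z \<Longrightarrow> (j, g, f') \<notin> K"
    using assms unfolding new_labels_def by blast
  have "\<not> V j g" if j: "x < j" "j \<le> z" for j
    using complete[OF x(5), of j] no[of j] x j by auto
  with x no show ?thesis using that by blast
qed

lemma new_labelsI:
  assumes "fst a = fst b" "fst a \<le> n" "covers_gap a b g" "(x, g, f) \<in> K" "x < fst a"
    "\<And>j f'. x < j \<Longrightarrow> j \<le> fst a \<Longrightarrow> (j, g, f') \<notin> K"
  shows "(fst a, g, f) \<in> new_labels n a b K"
  using assms by (auto simp: new_labels_def)

text \<open>A copied label was present in its strip before, so \<open>alive\<close> does not change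
  and \<open>pairs\<close> is inherited. The other conditions require the copy to behave like its
  source in every row y with (f, y) outside the new Y. Any deviation would force a horizontal line
  running left to the source, hence a point of P on it, against \<open>cross_free\<close>.\<close>

lemma flip:
  fixes a b :: point
  defines "E \<equiv> \<lambda>x g. fst a = fst b \<and> x = fst a \<and> covers_gap a b g"
    and "K1 \<equiv> K \<union> new_labels n a b K"
  assumes good1: "good n (P \<union> {a, b}) (\<lambda>x g. V x g \<or> E x g) H1"
    and H1: "\<And>x y. H x y \<Longrightarrow> H1 x y"
    and inner: "\<And>y. fst a = fst b \<Longrightarrow> min (snd a) (snd b) < y \<Longrightarrow> y < max (snd a) (snd b) \<Longrightarrow> (fst a, y) \<notin> P"
  shows "labelling n (P \<union> {a, b}) (\<lambda>x g. V x g \<or> E x g) H1 K1 (Y \<union> touched n a K1 \<union> touched n b K1)"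
proof -
  define P1 where "P1 = P \<union> {a, b}"
  define V1 where "V1 = (\<lambda>x g. V x g \<or> E x g)"
  define Y1 where "Y1 = Y \<union> touched n a K1 \<union> touched n b K1"
  note good1 = good1[folded P1_def V1_def]
  have alive1: "alive K1 f g \<longleftrightarrow> alive K f g" for f g
  proof
    assume "alive K1 f g"
    then obtain x where "(x, g, f) \<in> K \<union> new_labels n a b K" by (auto simp: alive_def K1_def)
    then show "alive K f g" by (auto elim!: new_labelsE intro: aliveI)
  qed (auto simp: alive_def K1_def)
  have touchedI: "(f, y) \<in> Y1" if "(x, g, f) \<in> K1" "(x, y) \<in> {a, b}" "y \<in> {1..n}" "g \<in> {y - 1, y}" for x y g f
    using that unfolding Y1_def touched_def by fastforce
  have Y1E: "\<exists>x g. (x, y) \<in> {a, b} \<and> (x, g, f) \<in> K1 \<and> y \<in> {1..n} \<and> g \<in> {y - 1, y}"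
    if fy: "(f, y) \<in> Y1" "(f, y) \<notin> Y" for f y
  proof -
    obtain p where p: "p \<in> {a, b}" "(f, y) \<in> touched n p K1" using fy unfolding Y1_def by blast
    obtain g where "y = snd p" "y \<in> {1..n}" "g \<in> {y - 1, y}" "(fst p, g, f) \<in> K1"
      using touchedD[OF p(2)] by blast
    moreover from this have "(fst p, y) \<in> {a, b}" using p(1) by auto
    ultimately show ?thesis by blast
  qed
  have range1: "x \<in> {1..n} \<and> f \<in> {1..n} \<and> V1 x g" if "(x, g, f) \<in> K1" for x g f
    using that[unfolded K1_def]
  proof
    assume "(x, g, f) \<in> new_labels n a b K"
    then obtain x' where "x = fst a" "fst a = fst b" "fst a \<le> n" "covers_gap a b g" "(x', g, f) \<in> K" "x' < x"
      by (rule new_labelsE) blast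
    with range[OF this(5)] show ?thesis by (auto simp: V1_def E_def)
  next
    assume "(x, g, f) \<in> K" from range[OF this] show ?thesis by (auto simp: V1_def)
  qed
  \<comment> \<open>A newly labelled edge at an endpoint of the flip yields only points already in
    Y. Otherwise no horizontal line reaches (z, y) from the left, before or after the flip, so after
    it there are vertical edges above and below (z, y). The one not covered by the flip is old and
    formerly ended at (z, y), and elbow-freeness of the old state demands a line from the left after
    all.\<close>
  have other_end: "(f, y) \<in> Y"
    if new: "(z, g, f) \<in> new_labels n a b K" and y: "y \<in> {1..n}" "g \<in> {y - 1, y}" and ab: "(z, y) \<in> {a, b}" for z g f y
  proof (rule ccontr)
    assume nY: "(f, y) \<notin> Y"
    obtain x where x: "z = fst a" "fst a = fst b" "fst a \<le> n" "covers_gap a b g" "(x, g, f) \<in> K" "x < z"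
      and no: "\<And>j. x < j \<Longrightarrow> j \<le> z \<Longrightarrow> \<not> V j g"
      using new by (rule new_labelsE) blast
    have x1: "1 \<le> x" and Vx: "V x g" using range[OF x(5)] by auto
    have zn: "z \<in> {1..n}" using x x1 by auto
    have xP: "(x, y) \<notin> P" by (rule cross_gaps(2)[OF nY y(1,2,2) x(5)])
    then have xP1: "(x, y) \<notin> P1" using x by (auto simp: P1_def)
    have noH: "\<not> H (z - 1) y"
      using good_next_left[OF good y x1 x(6) _ _ _ Vx] no xP zn by auto
    have noH1: "\<not> H1 (z - 1) y"
    proof
      assume "H1 (z - 1) y"
      moreover have "\<not> V1 j g" if "x < j" "j < z" for j
        using no that x by (auto simp: V1_def E_def)
      moreover have "V1 x g" using Vx by (simp add: V1_def)
      ultimately show False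
        using good_next_left[OF good1 y x1 x(6)] zn xP1 by auto
    qed
    have zP1: "(z, y) \<in> P1" using ab by (auto simp: P1_def)
    have V1z: "V1 z k" if "k \<in> {y - 1, y}" for k
      using good_straight(1)[OF good1 zn y(1) zP1 that] noH1 by blast
    define g' where "g' = (if g = y then y - 1 else y)"
    have g': "g' \<in> {y - 1, y}" "g' \<noteq> g" using y by (auto simp: g'_def)
    have "y = snd a \<or> y = snd b" using ab by auto
    then have "\<not> covers_gap a b g'" using g' x(4) y by (auto simp: covers_gap_def)
    then have "V z g'" using V1z[OF g'(1)] by (auto simp: V1_def E_def)
    moreover have "\<not> V z g" using no x by simp
    ultimately have "(z, y) \<in> P" using good_through[OF good zn y(1) _ y(2) g'(1)] by blast
    from good_straight(1)[OF good zn y(1) this y(2) \<open>\<not> V z g\<close>] noH show False by contradiction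
  qed
  \<comment> \<open>The point (z, y) is no endpoint, or (f, y) would be in \<open>Y1\<close>, so the
    flip passes through row y. The source crosses y with the same label and is still the nearest
    labelled edge in the other strip: an edge between source and copy there would end in row y and
    send a horizontal line left to the source.\<close>
  have new_cross: "(z, g', f) \<in> K1 \<and> (z, y) \<notin> P1"
    if new: "(z, g, f) \<in> new_labels n a b K" and nY: "(f, y) \<notin> Y1" and y: "y \<in> {1..n}" "g \<in> {y - 1, y}"
      and g': "g' \<in> {y - 1, y}" for z g g' f y
  proof
    obtain x where x: "z = fst a" "fst a = fst b" "fst a \<le> n" "covers_gap a b g" "(x, g, f) \<in> K" "x < z"
      and no: "\<And>j. x < j \<Longrightarrow> j \<le> z \<Longrightarrow> \<not> V j g"
      using new by (rule new_labelsE) blast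
    have x1: "1 \<le> x" and Vx: "V x g" using range[OF x(5)] by auto
    have nY0: "(f, y) \<notin> Y" using nY by (simp add: Y1_def)
    have xP: "(x, y) \<notin> P" and xg': "(x, g', f) \<in> K"
      using cross_gaps[OF nY0 y g' x(5)] by auto
    have nab: "(z, y) \<notin> {a, b}" using touchedI[OF _ _ y] new nY by (auto simp: K1_def)
    have ra: "(fst a, snd a) = a" "(fst a, snd b) = b" using x(2) by (simp_all add: prod_eq_iff)
    have "y \<noteq> snd a" "y \<noteq> snd b" using nab x(1) ra by auto
    then have strict: "min (snd a) (snd b) < y" "y < max (snd a) (snd b)"
      using y x(4) by (auto simp: covers_gap_def)
    show zP1: "(z, y) \<notin> P1" using inner[OF x(2) strict] nab x(1) by (auto simp: P1_def)
    then have zP: "(z, y) \<notin> P" by (simp add: P1_def)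
    have cov: "covers_gap a b g'" using strict g' by (auto simp: covers_gap_def)
    have "(j, g', f') \<notin> K" if j: "x < j" "j \<le> z" for j f'
    proof
      assume jK: "(j, g', f') \<in> K"
      have jn: "j \<in> {1..n}" and Vj: "V j g'" using range[OF jK] by auto
      have nVj: "\<not> V j g" using no j by blast
      then have jP: "(j, y) \<in> P" using good_through[OF good jn y(1) _ y(2) g'] Vj by blast
      from good_straight(1)[OF good jn y(1) jP y(2) nVj] have "H (j - 1) y" .
      then have "(x, y) \<in> P"
        using good_next_left[OF good y x1 j(1) _ _ _ Vx] no j jn by auto
      then show False using xP by contradiction
    qed
    then show "(z, g', f) \<in> K1"
      using new_labelsI[OF x(2,3) cov xg'] x by (simp add: K1_def)
  qed
  have complete1: "\<exists>f'. (x', g, f') \<in> K1" if K1: "(x, g, f) \<in> K1" and xx: "x < x'" "x' \<le> n" and V: "V1 x' g" for x g f x'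
  proof -
    have "\<exists>x0<x'. (x0, g, f) \<in> K"
      using K1[unfolded K1_def]
    proof
      assume "(x, g, f) \<in> new_labels n a b K"
      then obtain z where "(z, g, f) \<in> K" "z < x" by (rule new_labelsE) blast
      then show ?thesis using xx by (meson less_trans)
    qed (use xx in blast)
    then obtain x0 where x0: "x0 < x'" "(x0, g, f) \<in> K" by blast
    show ?thesis
    proof (cases "V x' g")
      case True
      from complete[OF x0(2,1) xx(2) True] show ?thesis by (auto simp: K1_def)
    next
      case False
      then have E: "fst a = fst b" "x' = fst a" "covers_gap a b g" using V by (auto simp: V1_def E_def)
      \<comment> \<open>Some labelled edge lies to the left, so the inserted edge has a nearest one
        to copy from.\<close>
      let ?D = "{d. d < x' \<and> (\<exists>f'. (d, g, f') \<in> K)}"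
      have fin: "finite ?D" by simp
      define m where "m = Max ?D"
      have "m \<in> ?D" unfolding m_def using x0 by (intro Max_in fin) auto
      then obtain h where h: "m < x'" "(m, g, h) \<in> K" by blast
      have no: "(j, g, f') \<notin> K" if j: "m < j" "j \<le> x'" for j f'
      proof
        assume jK: "(j, g, f') \<in> K"
        then have "j \<noteq> x'" using range False by blast
        then have "j \<in> ?D" using jK j by auto
        then have "j \<le> m" unfolding m_def by (intro Max_ge fin)
        then show False using j by simp
      qed
      have "(fst a, g, h) \<in> new_labels n a b K"
        by (rule new_labelsI[OF E(1) _ E(3) h(2) _ no]) (use h(1) xx E(2) in simp_all)
      then have "(x', g, h) \<in> new_labels n a b K" unfolding E(2) .
      then show ?thesis by (auto simp: K1_def)
    qed
  qed
  have "labelling n P1 V1 H1 K1 Y1"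
  proof (unfold_locales, goal_cases)
    case 1 show ?case by (rule good1)
  next
    case (2 x g f) then show ?case by (rule range1)
  next
    case (3 x g f f')
    have *: False if "(x, g, h) \<in> K" "(x, g, h') \<in> new_labels n a b K" for h h'
      using that(2) by (rule new_labelsE) (use that(1) in blast)
    have **: "h = h'" if h: "(x, g, h) \<in> new_labels n a b K" "(x, g, h') \<in> new_labels n a b K" for h h'
    proof -
      obtain z where z: "(z, g, h) \<in> K" "z < x" "\<And>j f'. z < j \<Longrightarrow> j \<le> x \<Longrightarrow> (j, g, f') \<notin> K"
        using h(1) by (rule new_labelsE) blast
      obtain z' where z': "(z', g, h') \<in> K" "z' < x" "\<And>j f'. z' < j \<Longrightarrow> j \<le> x \<Longrightarrow> (j, g, f') \<notin> K"
        using h(2) by (rule new_labelsE) blast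
      have "z = z'" using z z' by (metis less_imp_le linorder_neqE_nat)
      then show ?thesis using functional z z' by blast
    qed
    show ?case using 3 functional * ** unfolding K1_def by blast
  next
    case (4 x g f x') then show ?case by (rule complete1)
  next
    case (5 x g f x' f')
    consider (old) "(x, g, f) \<in> K" "(x', g, f') \<in> K" | (left) "(x, g, f) \<in> new_labels n a b K" "(x', g, f') \<in> K"
      | (right) "(x, g, f) \<in> K" "(x', g, f') \<in> new_labels n a b K"
      | (both) "(x, g, f) \<in> new_labels n a b K" "(x', g, f') \<in> new_labels n a b K"
      using 5 unfolding K1_def by blast
    then show ?case
    proof cases
      case old then show ?thesis using sorted 5 by blast
    next
      case left
      obtain z where "(z, g, f) \<in> K" "z < x" using left(1) by (rule new_labelsE) blast
      then show ?thesis using sorted_le[OF _ left(2)] 5 by simp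
    next
      case right
      obtain z where z: "(z, g, f') \<in> K" "\<And>j f'. z < j \<Longrightarrow> j \<le> x' \<Longrightarrow> (j, g, f') \<notin> K"
        using right(2) by (rule new_labelsE) blast
      have "x \<le> z" using z(2)[of x] right(1) 5 by (meson less_imp_le not_le)
      then show ?thesis using sorted_le[OF right(1) z(1)] by blast
    next
      case both
      have "x = fst a" "x' = fst a" using both by (auto elim!: new_labelsE)
      then show ?thesis using 5 by simp
    qed
  next
    case (6 f y x)
    have nY: "(f, y) \<notin> Y" using 6 by (simp add: Y1_def)
    have g: "y \<in> {y - 1, y}" "y - 1 \<in> {y - 1, y}" by auto
    show ?case
      using cross[OF nY 6(2)] new_cross[OF _ 6 g(1,2)] new_cross[OF _ 6 g(2,1)] unfolding K1_def by blast
  next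
    case (7 f y x)
    have nY: "(f, y) \<notin> Y" using 7 by (simp add: Y1_def)
    have g: "y \<in> {y - 1, y}" by auto
    from 7(3)[unfolded K1_def] show ?case
    proof
      assume xK: "(x, y, f) \<in> K"
      have "(x, y) \<notin> {a, b}" using touchedI[OF 7(3) _ 7(2) g] 7(1) by blast
      then show ?thesis using cross_free[OF nY 7(2) xK] by (simp add: P1_def)
    next
      assume "(x, y, f) \<in> new_labels n a b K"
      from new_cross[OF this 7(1,2) g g] show ?thesis ..
    qed
  next
    case (8 f y g)
    have al: "alive K f g" using 8(3) alive1 by blast
    have old: ?case if "(f, y) \<in> Y"
      using touch[OF that 8(2) al] by (auto simp: K1_def P1_def)
    show ?case
    proof (cases "(f, y) \<in> Y")
      case True then show ?thesis by (rule old)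
    next
      case False
      then obtain x g0 where x: "(x, y) \<in> {a, b}" "(x, g0, f) \<in> K1" and y: "y \<in> {1..n}" "g0 \<in> {y - 1, y}"
        using Y1E[OF 8(1)] by blast
      \<comment> \<open>By \<open>other_end\<close>, the edge responsible for a new point was
        labelled before the flip. It then crosses row y with its label, so it serves for either
        adjacent strip g.\<close>
      have "(x, g0, f) \<notin> new_labels n a b K" using other_end[OF _ y x(1)] False by blast
      then have "(x, g0, f) \<in> K" using x(2) by (simp add: K1_def)
      from cross_gaps(1)[OF False y 8(2) this] have "(x, g, f) \<in> K1" by (simp add: K1_def)
      moreover have "(x, y) \<in> P1" using x(1) by (auto simp: P1_def)
      ultimately show ?thesis by blast
    qed
  next
    case 9
    show ?case
    proof -
      have "touched n p K1 \<subseteq> {1..n} \<times> {1..n}" for p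
      proof
        fix z assume "z \<in> touched n p K1"
        moreover obtain f y where "z = (f, y)" by (cases z)
        ultimately show "z \<in> {1..n} \<times> {1..n}" using touchedD range1 by blast
      qed
      then show ?thesis using Y_grid unfolding Y1_def by blast
    qed
  next
    case (10 x1 x2 y1 y2)
    have stay: "(f, y) \<notin> Y1" if "(f, y) \<notin> Y" "\<forall>g\<in>{y - 1, y}. \<not> alive K f g" for f y
    proof
      assume "(f, y) \<in> Y1"
      from Y1E[OF this that(1)] obtain x g where "(x, g, f) \<in> K1" "g \<in> {y - 1, y}" by blast
      then show False using that(2) aliveI[of x g f K1] alive1[of f g] by blast
    qed
    show ?case
      using pairs[OF 10] stay[of x1 y1] stay[of x2 y2] unfolding alive1 Y1_def by blast
  qed
  then show ?thesis unfolding P1_def V1_def Y1_def .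
qed

text \<open>The point borders two unit edges, one above and one below, and each carries at most one
  label.\<close>

lemma card_touched: "card (touched n p K) \<le> 2"
proof -
  let ?T = "\<lambda>g. {(f, snd p) | f. (fst p, g, f) \<in> K}"
  have *: "card (?T g) \<le> 1 \<and> finite (?T g)" for g
  proof (cases "?T g = {}")
    case False
    then obtain f where "(fst p, g, f) \<in> K" by blast
    then have "?T g = {(f, snd p)}" using functional by blast
    then show ?thesis by simp
  qed simp
  have "touched n p K \<subseteq> ?T (snd p) \<union> ?T (snd p - 1)"
    unfolding touched_def by auto
  then have "card (touched n p K) \<le> card (?T (snd p) \<union> ?T (snd p - 1))"
    using * by (intro card_mono) auto
  also have "\<dots> \<le> card (?T (snd p)) + card (?T (snd p - 1))" by (rule card_Un_le)
  also have "\<dots> \<le> 2" using *[of "snd p"] *[of "snd p - 1"] by linarith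
  finally show ?thesis .
qed

end

section \<open>From states to labellings\<close>

text \<open>Passing to unit edges makes subdivision invisible: splitting a segment at an interior
  point changes the set of segments but not its unit edges.\<close>

definition vedge :: "segment set \<Rightarrow> nat \<Rightarrow> nat \<Rightarrow> bool" where
  "vedge L x g \<longleftrightarrow> (\<exists>s\<in>L. (x, g) \<in> seg_points s \<and> (x, Suc g) \<in> seg_points s)"

definition hedge :: "segment set \<Rightarrow> nat \<Rightarrow> nat \<Rightarrow> bool" where
  "hedge L x y \<longleftrightarrow> (\<exists>s\<in>L. (x, y) \<in> seg_points s \<and> (Suc x, y) \<in> seg_points s)"

definition axis_parallel :: "segment \<Rightarrow> bool" where
  "axis_parallel s \<longleftrightarrow> horizontal s \<or> vertical s"

lemma seg_points_pair: "seg_points {a, b} = box a b"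
proof -
  have "seg_points {a, b} = box a a \<union> box a b \<union> (box b a \<union> box b b)"
    by (simp add: seg_points_def)
  moreover have "box b a = box a b" by (simp add: box_def min.commute max.commute)
  moreover have "box a a \<subseteq> box a b" "box b b \<subseteq> box a b"
    by (cases a, cases b, auto simp: box_def)+
  ultimately show ?thesis by blast
qed

lemma axis_parallelE:
  assumes "axis_parallel s"
  obtains a b where "s = {a, b}" "a \<noteq> b" "fst a = fst b \<or> snd a = snd b"
  using assms unfolding axis_parallel_def horizontal_def vertical_def by blast

lemma vertical_pair: "vertical {a, b} \<longleftrightarrow> a \<noteq> b \<and> fst a = fst b"
proof
  assume "a \<noteq> b \<and> fst a = fst b"
  then show "vertical {a, b}" unfolding vertical_def by blast
qed (auto simp: vertical_def doubleton_eq_iff)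

lemma horizontal_pair: "horizontal {a, b} \<longleftrightarrow> a \<noteq> b \<and> snd a = snd b"
proof
  assume "a \<noteq> b \<and> snd a = snd b"
  then show "horizontal {a, b}" unfolding horizontal_def by blast
qed (auto simp: horizontal_def doubleton_eq_iff)

lemma axis_parallel_pair: "axis_parallel {a, b} \<longleftrightarrow> a \<noteq> b \<and> (fst a = fst b \<or> snd a = snd b)"
  by (auto simp: axis_parallel_def vertical_pair horizontal_pair)

lemma box_vedge:
  "fst a = fst b \<or> snd a = snd b \<Longrightarrow>
    (x, g) \<in> box a b \<and> (x, Suc g) \<in> box a b \<longleftrightarrow> fst a = fst b \<and> x = fst a \<and> covers_gap a b g"
  by (auto simp: box_def covers_gap_def min_def max_def)

lemma box_hedge:
  "fst a = fst b \<or> snd a = snd b \<Longrightarrow>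
    (x, y) \<in> box a b \<and> (Suc x, y) \<in> box a b \<longleftrightarrow>
    snd a = snd b \<and> y = snd a \<and> (fst a \<le> x \<and> x < fst b \<or> fst b \<le> x \<and> x < fst a)"
  by (auto simp: box_def min_def max_def)

lemma vedge_insert_pair:
  assumes "axis_parallel {a, b}"
  shows "vedge (insert {a, b} L) x g \<longleftrightarrow> vedge L x g \<or> fst a = fst b \<and> x = fst a \<and> covers_gap a b g"
  using assms box_vedge[of a b x g] by (auto simp: vedge_def seg_points_pair axis_parallel_pair)

lemma hedge_insert_pair:
  assumes "axis_parallel {a, b}"
  shows "hedge (insert {a, b} L) x y \<longleftrightarrow> hedge L x y \<or>
    snd a = snd b \<and> y = snd a \<and> (fst a \<le> x \<and> x < fst b \<or> fst b \<le> x \<and> x < fst a)"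
  using assms box_hedge[of a b x y] by (auto simp: hedge_def seg_points_pair axis_parallel_pair)

lemma split_segment:
  assumes "axis_parallel s" "c \<in> seg_interior s"
  obtains a b where "s = {a, b}" "axis_parallel {a, c}" "axis_parallel {b, c}"
    "\<And>x g. vedge {{a, c}, {b, c}} x g \<longleftrightarrow> vedge {s} x g"
    "\<And>x y. hedge {{a, c}, {b, c}} x y \<longleftrightarrow> hedge {s} x y"
proof -
  obtain a b where s: "s = {a, b}" and ab: "a \<noteq> b" "fst a = fst b \<or> snd a = snd b"
    using assms(1) by (rule axis_parallelE)
  have c: "c \<in> box a b" "c \<noteq> a" "c \<noteq> b"
    using assms(2) by (auto simp: seg_interior_def s seg_points_pair)
  have c': "fst a = fst b \<and> fst c = fst a \<and> (snd a < snd c \<and> snd c < snd b \<or> snd b < snd c \<and> snd c < snd a) \<or>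
    snd a = snd b \<and> snd c = snd a \<and> (fst a < fst c \<and> fst c < fst b \<or> fst b < fst c \<and> fst c < fst a)"
  proof -
    obtain a1 a2 b1 b2 c1 c2 where [simp]: "a = (a1, a2)" "b = (b1, b2)" "c = (c1, c2)"
      by (cases a, cases b, cases c)
    have "min a1 b1 \<le> c1" "c1 \<le> max a1 b1" "min a2 b2 \<le> c2" "c2 \<le> max a2 b2"
      using c(1) by (simp_all add: box_def)
    then show ?thesis using c(2,3) ab by (auto simp: min_def max_def split: if_splits)
  qed
  have ac: "axis_parallel {a, c}" and bc: "axis_parallel {b, c}"
    using c' by (auto simp: axis_parallel_pair)
  have V: "vedge {{a, c}, {b, c}} x g \<longleftrightarrow> vedge {s} x g" for x g
  proof -
    have "vedge {s} x g \<longleftrightarrow> fst a = fst b \<and> x = fst a \<and> covers_gap a b g"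
      using vedge_insert_pair[of a b "{}"] ab by (simp add: s axis_parallel_pair vedge_def)
    moreover have "vedge {{a, c}, {b, c}} x g \<longleftrightarrow>
      fst a = fst c \<and> x = fst a \<and> covers_gap a c g \<or> fst b = fst c \<and> x = fst b \<and> covers_gap b c g"
      using vedge_insert_pair[OF ac, of "{{b, c}}"] vedge_insert_pair[OF bc, of "{}"]
      by (auto simp: vedge_def)
    moreover have "(fst a = fst b \<and> x = fst a \<and> covers_gap a b g) \<longleftrightarrow>
      fst a = fst c \<and> x = fst a \<and> covers_gap a c g \<or> fst b = fst c \<and> x = fst b \<and> covers_gap b c g"
      using c'
    proof
      assume "fst a = fst b \<and> fst c = fst a \<and> (snd a < snd c \<and> snd c < snd b \<or> snd b < snd c \<and> snd c < snd a)"
      moreover from this have "covers_gap a b g \<longleftrightarrow> covers_gap a c g \<or> covers_gap b c g"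
        unfolding covers_gap_def by linarith
      ultimately show ?thesis by (simp, blast?)
    qed auto
    ultimately show ?thesis by simp
  qed
  have H: "hedge {{a, c}, {b, c}} x y \<longleftrightarrow> hedge {s} x y" for x y
  proof -
    have "hedge {s} x y \<longleftrightarrow> snd a = snd b \<and> y = snd a \<and> (fst a \<le> x \<and> x < fst b \<or> fst b \<le> x \<and> x < fst a)"
      using hedge_insert_pair[of a b "{}"] ab by (simp add: s axis_parallel_pair hedge_def)
    moreover have "hedge {{a, c}, {b, c}} x y \<longleftrightarrow>
      snd a = snd c \<and> y = snd a \<and> (fst a \<le> x \<and> x < fst c \<or> fst c \<le> x \<and> x < fst a) \<or>
      snd b = snd c \<and> y = snd b \<and> (fst b \<le> x \<and> x < fst c \<or> fst c \<le> x \<and> x < fst b)"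
      using hedge_insert_pair[OF ac, of "{{b, c}}"] hedge_insert_pair[OF bc, of "{}"]
      by (auto simp: hedge_def)
    moreover have "(snd a = snd b \<and> y = snd a \<and> (fst a \<le> x \<and> x < fst b \<or> fst b \<le> x \<and> x < fst a)) \<longleftrightarrow>
      snd a = snd c \<and> y = snd a \<and> (fst a \<le> x \<and> x < fst c \<or> fst c \<le> x \<and> x < fst a) \<or>
      snd b = snd c \<and> y = snd b \<and> (fst b \<le> x \<and> x < fst c \<or> fst c \<le> x \<and> x < fst b)"
      using c'
    proof
      assume "snd a = snd b \<and> snd c = snd a \<and> (fst a < fst c \<and> fst c < fst b \<or> fst b < fst c \<and> fst c < fst a)"
      moreover from this have "(fst a \<le> x \<and> x < fst b \<or> fst b \<le> x \<and> x < fst a) \<longleftrightarrow>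
        (fst a \<le> x \<and> x < fst c \<or> fst c \<le> x \<and> x < fst a) \<or> (fst b \<le> x \<and> x < fst c \<or> fst c \<le> x \<and> x < fst b)"
        by linarith
      ultimately show ?thesis by (simp, blast?)
    qed auto
    ultimately show ?thesis by simp
  qed
  show ?thesis using that[OF s ac bc V H] .
qed

lemma split_at_edges:
  assumes "\<And>s. s \<in> L \<Longrightarrow> axis_parallel s"
  shows "vedge (split_at c L) x g \<longleftrightarrow> vedge L x g" "hedge (split_at c L) x y \<longleftrightarrow> hedge L x y"
    "s \<in> split_at c L \<Longrightarrow> axis_parallel s"
proof -
  have V: "vedge L x g \<longleftrightarrow> (\<exists>s\<in>L. vedge {s} x g)" for L x g by (simp add: vedge_def)
  have H: "hedge L x y \<longleftrightarrow> (\<exists>s\<in>L. hedge {s} x y)" for L x y by (simp add: hedge_def)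
  have piece: "axis_parallel {q, c} \<and> (vedge {{q, c}} x g \<longrightarrow> vedge {s} x g) \<and> (hedge {{q, c}} x y \<longrightarrow> hedge {s} x y)"
    if s: "s \<in> L" "c \<in> seg_interior s" "q \<in> s" for s q
  proof -
    obtain a b where "s = {a, b}" "axis_parallel {a, c}" "axis_parallel {b, c}"
      "\<And>x g. vedge {{a, c}, {b, c}} x g \<longleftrightarrow> vedge {s} x g"
      "\<And>x y. hedge {{a, c}, {b, c}} x y \<longleftrightarrow> hedge {s} x y"
      using split_segment[OF assms[OF s(1)] s(2)] by blast
    then show ?thesis using s(3) V[of "{{a, c}, {b, c}}" x g] H[of "{{a, c}, {b, c}}" x y] by auto
  qed
  have cover: "(vedge {s} x g \<longrightarrow> (\<exists>q\<in>s. vedge {{q, c}} x g)) \<and> (hedge {s} x y \<longrightarrow> (\<exists>q\<in>s. hedge {{q, c}} x y))"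
    if s: "s \<in> L" "c \<in> seg_interior s" for s
  proof -
    obtain a b where "s = {a, b}" "axis_parallel {a, c}" "axis_parallel {b, c}"
      "\<And>x g. vedge {{a, c}, {b, c}} x g \<longleftrightarrow> vedge {s} x g"
      "\<And>x y. hedge {{a, c}, {b, c}} x y \<longleftrightarrow> hedge {s} x y"
      using split_segment[OF assms[OF s(1)] s(2)] by blast
    then show ?thesis using V[of "{{a, c}, {b, c}}" x g] H[of "{{a, c}, {b, c}}" x y] by auto
  qed
  show "vedge (split_at c L) x g \<longleftrightarrow> vedge L x g"
  proof -
    have "vedge (split_at c L) x g \<longleftrightarrow> (\<exists>s\<in>split_at c L. vedge {s} x g)" by (rule V)
    also have "\<dots> \<longleftrightarrow> (\<exists>s\<in>L. vedge {s} x g)" unfolding split_at_def using piece cover by blast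
    also have "\<dots> \<longleftrightarrow> vedge L x g" by (rule V[symmetric])
    finally show ?thesis .
  qed
  show "hedge (split_at c L) x y \<longleftrightarrow> hedge L x y"
  proof -
    have "hedge (split_at c L) x y \<longleftrightarrow> (\<exists>s\<in>split_at c L. hedge {s} x y)" by (rule H)
    also have "\<dots> \<longleftrightarrow> (\<exists>s\<in>L. hedge {s} x y)" unfolding split_at_def using piece cover by blast
    also have "\<dots> \<longleftrightarrow> hedge L x y" by (rule H[symmetric])
    finally show ?thesis .
  qed
  show "s \<in> split_at c L \<Longrightarrow> axis_parallel s"
    unfolding split_at_def using piece assms by blast
qed

text \<open>The last conclusion, that new horizontal edges lie in the row of the first endpoint,
  later serves to bound the number of flips from below.\<close>

lemma flip_edges:
  assumes L: "\<And>s. s \<in> L \<Longrightarrow> axis_parallel s" and ab: "axis_parallel {a, b}" and f: "flip a b (P, L) = (P', L')"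
  shows "vedge L' x g \<longleftrightarrow> vedge L x g \<or> fst a = fst b \<and> x = fst a \<and> covers_gap a b g"
    and "hedge L x y \<Longrightarrow> hedge L' x y" and "hedge L' x y \<Longrightarrow> hedge L x y \<or> y = snd a"
proof -
  note A = split_at_edges(3)[where L = L and c = a, OF L]
  have L': "L' = insert {a, b} (split_at b (split_at a L))" using f by (simp add: flip_def)
  have V: "vedge (split_at b (split_at a L)) x g \<longleftrightarrow> vedge L x g" for x g
    using split_at_edges(1)[where L = "split_at a L" and c = b] split_at_edges(1)[where L = L and c = a] A L by blast
  have H: "hedge (split_at b (split_at a L)) x g \<longleftrightarrow> hedge L x g" for x g
    using split_at_edges(2)[where L = "split_at a L" and c = b] split_at_edges(2)[where L = L and c = a] A L by blast
  show "vedge L' x g \<longleftrightarrow> vedge L x g \<or> fst a = fst b \<and> x = fst a \<and> covers_gap a b g"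
    unfolding L' vedge_insert_pair[OF ab] V ..
  show "hedge L x y \<Longrightarrow> hedge L' x y" "hedge L' x y \<Longrightarrow> hedge L x y \<or> y = snd a"
    unfolding L' hedge_insert_pair[OF ab] H by blast+
qed

section \<open>Valid states satisfy the local condition\<close>

context
  fixes n :: nat and P :: "point set" and L :: "segment set"
  assumes valid: "valid_state n (P, L)"
begin

lemmas valid_unfolded = valid[unfolded valid_state_def prod.case]

lemmas valid_parts = valid_unfolded[THEN conjunct1] valid_unfolded[THEN conjunct2, THEN conjunct1]
  valid_unfolded[THEN conjunct2, THEN conjunct2, THEN conjunct1]
  valid_unfolded[THEN conjunct2, THEN conjunct2, THEN conjunct2]

lemma valid_axis_parallel: "s \<in> L \<Longrightarrow> axis_parallel s"
  using valid_parts(1) unfolding is_state_def prod.case axis_parallel_def by (elim conjE) (drule (1) bspec, erule conjunct1)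

lemma valid_ends: "s \<in> L \<Longrightarrow> seg_points s \<inter> P = s"
  using valid_parts(2) by (rule bspec)

text \<open>Two common points are endpoints of both segments, and a segment is the pair of its
  endpoints.\<close>

lemma valid_disjoint: "s \<in> L \<Longrightarrow> t \<in> L \<Longrightarrow> p \<noteq> q \<Longrightarrow>
    {p, q} \<subseteq> seg_points s \<Longrightarrow> {p, q} \<subseteq> seg_points t \<Longrightarrow> s = t"
proof (rule ccontr)
  assume st: "s \<in> L" "t \<in> L" "p \<noteq> q" "{p, q} \<subseteq> seg_points s" "{p, q} \<subseteq> seg_points t" "s \<noteq> t"
  then have sub: "{p, q} \<subseteq> s \<inter> t"
    using valid_parts(3)[rule_format, of s t] by blast
  obtain a b where "s = {a, b}" using valid_axis_parallel[OF st(1)] by (rule axis_parallelE)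
  moreover obtain a' b' where "t = {a', b'}" using valid_axis_parallel[OF st(2)] by (rule axis_parallelE)
  ultimately show False using sub st by auto
qed

lemma valid_cross: "s \<in> L \<Longrightarrow> t \<in> L \<Longrightarrow> s \<noteq> t \<Longrightarrow> p \<in> seg_points s \<Longrightarrow> p \<in> seg_points t \<Longrightarrow> p \<in> P"
  using valid_parts(3)[rule_format, of s t] valid_ends[of s] by blast

text \<open>Outside P, every segment through the grid point passes straight, and two distinct ones
  cannot meet there. At a point of P all segments through it end. If neither direction is straight,
  there is at most one vertical and at most one horizontal segment; as at least two are required,
  they would form an elbow.\<close>

lemma valid_good: "good n P (vedge L) (hedge L)"
  unfolding good_def
proof (intro ballI)
  fix x y assume xy: "x \<in> {1..n}" "y \<in> {1..n}"
  have x: "Suc (x - 1) = x" and y: "Suc (y - 1) = y" using xy by auto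
  have nm: "(x, y) \<in> nonmargin n" using xy by (simp add: nonmargin_def)
  show "if (x, y) \<in> P then vedge L x (y - 1) \<and> vedge L x y \<or> hedge L (x - 1) y \<and> hedge L x y
        else vedge L x (y - 1) = vedge L x y \<and> hedge L (x - 1) y = hedge L x y \<and>
             \<not> (vedge L x y \<and> hedge L x y)"
  proof (cases "(x, y) \<in> P")
    case False
    have through: "(vedge {s} x (y - 1) \<longleftrightarrow> vedge {s} x y) \<and> (hedge {s} (x - 1) y \<longleftrightarrow> hedge {s} x y)
       \<and> \<not> (vedge {s} x y \<and> hedge {s} x y)" if s: "s \<in> L" for s
    proof -
      obtain a b where ab: "s = {a, b}" and ap: "axis_parallel {a, b}"
        using valid_axis_parallel[OF s] by (metis axis_parallelE)
      have ne: "x \<noteq> fst a \<or> y \<noteq> snd a" "x \<noteq> fst b \<or> y \<noteq> snd b"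
      proof -
        have "a \<in> P" "b \<in> P" using valid_ends[OF s] ab(1) by blast+
        then have "a \<noteq> (x, y)" "b \<noteq> (x, y)" using False by blast+
        then show "x \<noteq> fst a \<or> y \<noteq> snd a" "x \<noteq> fst b \<or> y \<noteq> snd b"
          by (simp_all add: prod_eq_iff) blast+
      qed
      have V: "vedge {s} x g \<longleftrightarrow> fst a = fst b \<and> x = fst a \<and> covers_gap a b g" for x g
        using vedge_insert_pair[OF ap, of "{}"] by (simp add: ab vedge_def)
      have H: "hedge {s} x y \<longleftrightarrow> snd a = snd b \<and> y = snd a \<and> (fst a \<le> x \<and> x < fst b \<or> fst b \<le> x \<and> x < fst a)" for x y
        using hedge_insert_pair[OF ap, of "{}"] by (simp add: ab hedge_def)
      have "vedge {s} x (y - 1) \<longleftrightarrow> vedge {s} x y"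
      proof (cases "fst a = fst b \<and> x = fst a")
        case True
        then have "y \<noteq> snd a" "y \<noteq> snd b" using ne by auto
        then have "covers_gap a b (y - 1) \<longleftrightarrow> covers_gap a b y"
          using y unfolding covers_gap_def by linarith
        then show ?thesis using V by simp
      qed (use V in auto)
      moreover have "hedge {s} (x - 1) y \<longleftrightarrow> hedge {s} x y"
      proof (cases "snd a = snd b \<and> y = snd a")
        case True
        then have "x \<noteq> fst a" "x \<noteq> fst b" using ne by auto
        then have "(fst a \<le> x - 1 \<and> x - 1 < fst b \<or> fst b \<le> x - 1 \<and> x - 1 < fst a) \<longleftrightarrow>
          (fst a \<le> x \<and> x < fst b \<or> fst b \<le> x \<and> x < fst a)"
          using x by linarith
        then show ?thesis using H by simp
      qed (use H in auto)
      moreover have "\<not> (vedge {s} x y \<and> hedge {s} x y)" using V H by auto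
      ultimately show ?thesis by blast
    qed
    have "vedge L x g \<longleftrightarrow> (\<exists>s\<in>L. vedge {s} x g)" "hedge L x g \<longleftrightarrow> (\<exists>s\<in>L. hedge {s} x g)" for x g
      by (auto simp: vedge_def hedge_def)
    moreover have "\<not> (vedge L x y \<and> hedge L x y)"
    proof
      assume "vedge L x y \<and> hedge L x y"
      then obtain s t where st: "s \<in> L" "t \<in> L" "vedge {s} x y" "hedge {t} x y"
        by (auto simp: vedge_def hedge_def)
      then have "s \<noteq> t" using through by blast
      then have "(x, y) \<in> P" using valid_cross[OF st(1,2)] st by (auto simp: vedge_def hedge_def)
      then show False using False by contradiction
    qed
    ultimately show ?thesis using through False by auto
  next
    case True
    define I where "I = {s \<in> L. (x, y) \<in> seg_points s}"
    from valid_parts(4) have I2: "card I \<ge> 2" and I2': "card I = 2 \<longrightarrow> (\<forall>s\<in>I. horizontal s) \<or> (\<forall>s\<in>I. vertical s)"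
      using True nm unfolding elbow_free_def I_def by (auto simp: Let_def)
    have fin: "finite I" using I2 by (metis card.infinite not_numeral_le_zero)
    have end_at: "\<exists>q. s = {(x, y), q} \<and> q \<noteq> (x, y) \<and> (fst q = x \<or> snd q = y)" if s: "s \<in> I" for s
    proof -
      have sL: "s \<in> L" using s by (simp add: I_def)
      obtain a b where ab: "s = {a, b}" "a \<noteq> b" "fst a = fst b \<or> snd a = snd b"
        using valid_axis_parallel[OF sL] by (rule axis_parallelE)
      have "(x, y) \<in> s" using valid_ends[OF sL] s True unfolding I_def by blast
      then consider "a = (x, y)" | "b = (x, y)" using ab(1) by blast
      then show ?thesis
      proof cases
        case 1
        then show ?thesis using ab by (intro exI[of _ b]) auto
      next
        case 2
        then show ?thesis using ab by (intro exI[of _ a]) auto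
      qed
    qed
    have one_v: "card {s \<in> I. vertical s} \<le> 1" if nv: "\<not> (vedge L x (y - 1) \<and> vedge L x y)"
    proof -
      obtain g where g: "g \<in> {y - 1, y}" "\<not> vedge L x g" using nv by blast
      \<comment> \<open>The side opposite to the missing edge: every vertical segment ending at (x,
        y) must contain this unit edge, so there is only one such segment.\<close>
      define g' where "g' = (if g = y then y - 1 else y)"
      have "(x, g') \<in> seg_points s \<and> (x, Suc g') \<in> seg_points s" if s: "s \<in> I" "vertical s" for s
      proof -
        obtain q where q: "s = {(x, y), q}" "q \<noteq> (x, y)" "fst q = x" using end_at[OF s(1)] s(2) by (auto simp: vertical_pair)
        have "\<not> ((x, g) \<in> seg_points s \<and> (x, Suc g) \<in> seg_points s)" using g(2) s(1) by (auto simp: vedge_def I_def)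
        moreover have "snd q \<noteq> y" using q by (auto simp: prod_eq_iff)
        ultimately show ?thesis using q(3) g(1) y unfolding q(1) seg_points_pair g'_def box_def
          by (auto simp: le_max_iff_disj min_le_iff_disj)
      qed
      then have "s = t" if "s \<in> {s \<in> I. vertical s}" "t \<in> {s \<in> I. vertical s}" for s t
        using that valid_disjoint[of s t "(x, g')" "(x, Suc g')"] by (auto simp: I_def)
      then show ?thesis using fin by (simp add: card_le_Suc0_iff_eq)
    qed
    have one_h: "card {s \<in> I. horizontal s} \<le> 1" if nv: "\<not> (hedge L (x - 1) y \<and> hedge L x y)"
    proof -
      obtain g where g: "g \<in> {x - 1, x}" "\<not> hedge L g y" using nv by blast
      define g' where "g' = (if g = x then x - 1 else x)"
      have "(g', y) \<in> seg_points s \<and> (Suc g', y) \<in> seg_points s" if s: "s \<in> I" "horizontal s" for s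
      proof -
        obtain q where q: "s = {(x, y), q}" "q \<noteq> (x, y)" "snd q = y" using end_at[OF s(1)] s(2) by (auto simp: horizontal_pair)
        have "\<not> ((g, y) \<in> seg_points s \<and> (Suc g, y) \<in> seg_points s)" using g(2) s(1) by (auto simp: hedge_def I_def)
        moreover have "fst q \<noteq> x" using q by (auto simp: prod_eq_iff)
        ultimately show ?thesis using q(3) g(1) x unfolding q(1) seg_points_pair g'_def box_def
          by (auto simp: le_max_iff_disj min_le_iff_disj)
      qed
      then have "s = t" if "s \<in> {s \<in> I. horizontal s}" "t \<in> {s \<in> I. horizontal s}" for s t
        using that valid_disjoint[of s t "(g', y)" "(Suc g', y)"] by (auto simp: I_def)
      then show ?thesis using fin by (simp add: card_le_Suc0_iff_eq)
    qed
    have "vedge L x (y - 1) \<and> vedge L x y \<or> hedge L (x - 1) y \<and> hedge L x y"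
    proof (rule ccontr)
      assume "\<not> ?thesis"
      then have le: "card {s \<in> I. vertical s} \<le> 1" "card {s \<in> I. horizontal s} \<le> 1"
        using one_v one_h by blast+
      have "I = {s \<in> I. vertical s} \<union> {s \<in> I. horizontal s}"
        using valid_axis_parallel by (auto simp: I_def axis_parallel_def)
      then have "card I \<le> card {s \<in> I. vertical s} + card {s \<in> I. horizontal s}"
        by (metis card_Un_le)
      then have "card I = 2" using le I2 by linarith
      then have "{s \<in> I. vertical s} = I \<or> {s \<in> I. horizontal s} = I" using I2' by blast
      then show False using le I2 by auto
    qed
    then show ?thesis using True by simp
  qed
qed

text \<open>In a valid state a unit edge belongs to a single segment, so no remaining segment can
  still cover an edge of a removed one.\<close>

lemma removal_edges:
  assumes "R \<subseteq> L"
  shows "vedge (L - R) x g \<longleftrightarrow> vedge L x g \<and> \<not> vedge R x g"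
proof -
  have "s = t" if "s \<in> L" "t \<in> L" "(x, g) \<in> seg_points s" "(x, Suc g) \<in> seg_points s"
    "(x, g) \<in> seg_points t" "(x, Suc g) \<in> seg_points t" for s t
    using valid_disjoint[OF that(1,2), of "(x, g)" "(x, Suc g)"] that by auto
  then show ?thesis using assms unfolding vedge_def by blast
qed

end

section \<open>The transformation\<close>

text \<open>The list counterpart of \<open>new_labels\<close>, phrased with projections and list
  searches because these are what the polynomial-time rules can decompose.\<close>

definition add_labels :: "nat \<Rightarrow> point \<Rightarrow> point \<Rightarrow> (nat \<times> nat \<times> nat) list \<Rightarrow> (nat \<times> nat \<times> nat) list" where
  "add_labels n a b K = collect
     (\<lambda>t. fst a = fst b \<and> fst a \<le> n \<and> covers_gap a b (fst (snd t)) \<and> fst t < fst a \<and>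
        \<not> (\<exists>u\<in>set K. fst (snd u) = fst (snd t) \<and> fst t < fst u \<and> fst u \<le> fst a))
     (\<lambda>t. (fst a, snd t)) K K"

definition drop_labels :: "(point \<times> point) list \<Rightarrow> (nat \<times> nat \<times> nat) list \<Rightarrow> (nat \<times> nat \<times> nat) list" where
  "drop_labels R K = collect
     (\<lambda>t. \<not> (\<exists>r\<in>set R. fst (fst r) = fst (snd r) \<and> fst (fst r) = fst t \<and> covers_gap (fst r) (snd r) (fst (snd t))))
     (\<lambda>t. t) K []"

definition touch_labels :: "nat \<Rightarrow> point \<Rightarrow> (nat \<times> nat \<times> nat) list \<Rightarrow> point list \<Rightarrow> point list" where
  "touch_labels n p K ys = collect
     (\<lambda>t. fst t = fst p \<and> 0 < snd p \<and> snd p \<le> n \<and> (snd p = fst (snd t) \<or> snd p = Suc (fst (snd t))))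
     (\<lambda>t. (snd (snd t), snd p)) K ys"

definition step :: "nat \<Rightarrow> (nat \<times> nat \<times> nat) list \<times> point list \<Rightarrow> move \<Rightarrow> (nat \<times> nat \<times> nat) list \<times> point list" where
  "step n s m = (drop_labels (snd (snd m)) (add_labels n (fst m) (fst (snd m)) (fst s)),
     touch_labels n (fst m) (add_labels n (fst m) (fst (snd m)) (fst s))
       (touch_labels n (fst (snd m)) (add_labels n (fst m) (fst (snd m)) (fst s)) (snd s)))"

definition numbered :: "nat list \<Rightarrow> nat \<times> point list" where
  "numbered xs = foldl (\<lambda>s x. (Suc (fst s), (x, Suc (fst s)) # snd s)) (0, []) xs"

text \<open>The strips 0 to n are enumerated by \<open>0 # xs\<close>: for a permutation this list
  has exactly these entries, though in a different order.\<close>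

definition initial_labels :: "nat list \<Rightarrow> (nat \<times> nat \<times> nat) list" where
  "initial_labels xs = foldl (\<lambda>acc x. collect (\<lambda>g. True) (\<lambda>g. (x, g, x)) (0 # xs) acc) [] xs"

definition transform :: "nat list \<Rightarrow> move list \<Rightarrow> point list" where
  "transform xs ms = snd (foldl (step (fst (numbered xs))) (initial_labels xs, snd (numbered xs)) ms)"

lemma set_add_labels: "set (add_labels n a b K) = set K \<union> new_labels n a b (set K)"
proof -
  have "(\<lambda>t. (fst a, snd t)) ` {t \<in> set K. fst a = fst b \<and> fst a \<le> n \<and> covers_gap a b (fst (snd t)) \<and> fst t < fst a \<and>
        \<not> (\<exists>u\<in>set K. fst (snd u) = fst (snd t) \<and> fst t < fst u \<and> fst u \<le> fst a)} = new_labels n a b (set K)"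
    (is "?f ` ?A = ?N")
  proof
    show "?f ` ?A \<subseteq> ?N" unfolding new_labels_def by force
    show "?N \<subseteq> ?f ` ?A"
    proof
      fix z assume "z \<in> ?N"
      then obtain x g f where z: "z = (fst a, g, f)" and c: "fst a = fst b" "fst a \<le> n" "covers_gap a b g"
        "(x, g, f) \<in> set K" "x < fst a" "\<forall>j f'. (j, g, f') \<in> set K \<longrightarrow> x < j \<longrightarrow> \<not> j \<le> fst a"
        unfolding new_labels_def by blast
      then have "\<not> (\<exists>u\<in>set K. fst (snd u) = g \<and> x < fst u \<and> fst u \<le> fst a)"
        by (metis prod.collapse)
      then have "(x, g, f) \<in> ?A" using c by simp
      then show "z \<in> ?f ` ?A" using z by force
    qed
  qed
  then show ?thesis unfolding add_labels_def set_collect by blast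
qed

lemma set_drop_labels:
  "set (drop_labels R K) = {(x, g, f) \<in> set K. \<not> (\<exists>(c, d)\<in>set R. fst c = fst d \<and> x = fst c \<and> covers_gap c d g)}"
  unfolding drop_labels_def set_collect by force

lemma set_touch_labels: "set (touch_labels n p K ys) = touched n p (set K) \<union> set ys"
  unfolding touch_labels_def set_collect touched_def by force

section \<open>Polynomial running time of the single operations\<close>

abbreviation enc_label :: "nat \<times> nat \<times> nat \<Rightarrow> tree" where
  "enc_label \<equiv> enc_pair enc_nat (enc_pair enc_nat enc_nat)"

text \<open>The body of a search receives its element paired with the surrounding input. This rule
  carries facts about the surrounding input into the body.\<close>

lemma ptime_lift:
  assumes "ptime D e e' f"
  shows "ptime (D \<times> UNIV) (enc_pair e e1) e' (\<lambda>z. f (fst z))"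
  by (rule ptime_comp[OF ptime_fst[OF ptime_id] assms]) auto

lemmas ptime_eq_nat = ptime_eq[OF _ _ inj_enc_nat]

text \<open>With the premise on the list in front, the encoding of its elements is determined before
  the body of the search is treated.\<close>

lemmas ptime_bex_rule = ptime_bex[rotated]

lemmas ptime_rules = ptime_id ptime_fst ptime_snd ptime_conj ptime_disj ptime_not ptime_eq_nat
  ptime_less ptime_le ptime_Pair ptime_Cons ptime_Nil ptime_0 ptime_Suc ptime_True

lemma ptime_covers_gap:
  assumes a: "ptime D e (enc_pair enc_nat enc_nat) a" and b: "ptime D e (enc_pair enc_nat enc_nat) b"
    and g: "ptime D e enc_nat g"
  shows "ptime D e enc_bool (\<lambda>x. covers_gap (a x) (b x) (g x))"
  unfolding covers_gap_def by (rule a b g ptime_rules)+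

lemma ptime_add_labels:
  assumes n: "ptime D e enc_nat n" and a: "ptime D e (enc_pair enc_nat enc_nat) a"
    and b: "ptime D e (enc_pair enc_nat enc_nat) b" and K: "ptime D e (enc_list enc_label) K"
  shows "ptime D e (enc_list enc_label) (\<lambda>x. add_labels (n x) (a x) (b x) (K x))"
  unfolding add_labels_def
proof (rule ptime_collect[OF _ _ K K])
  note lifted = n[THEN ptime_lift] a[THEN ptime_lift] b[THEN ptime_lift] K[THEN ptime_lift]
  note lifted2 = lifted[THEN ptime_lift]
  show "ptime (D \<times> UNIV) (enc_pair e enc_label) enc_bool
     (\<lambda>z. fst (a (fst z)) = fst (b (fst z)) \<and> fst (a (fst z)) \<le> n (fst z) \<and>
        covers_gap (a (fst z)) (b (fst z)) (fst (snd (snd z))) \<and> fst (snd z) < fst (a (fst z)) \<and>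
        \<not> (\<exists>u\<in>set (K (fst z)). fst (snd u) = fst (snd (snd z)) \<and> fst (snd z) < fst u \<and> fst u \<le> fst (a (fst z))))"
    by (rule lifted2 lifted ptime_bex_rule ptime_covers_gap ptime_rules)+
  show "ptime (D \<times> UNIV) (enc_pair e enc_label) enc_label (\<lambda>z. (fst (a (fst z)), snd (snd z)))"
    by (rule lifted ptime_rules)+
qed

lemma ptime_drop_labels:
  assumes R: "ptime D e (enc_list (enc_pair (enc_pair enc_nat enc_nat) (enc_pair enc_nat enc_nat))) R"
    and K: "ptime D e (enc_list enc_label) K"
  shows "ptime D e (enc_list enc_label) (\<lambda>x. drop_labels (R x) (K x))"
  unfolding drop_labels_def
proof (rule ptime_collect[OF _ _ K ptime_Nil])
  note lifted = R[THEN ptime_lift]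
  show "ptime (D \<times> UNIV) (enc_pair e enc_label) enc_bool
     (\<lambda>z. \<not> (\<exists>r\<in>set (R (fst z)). fst (fst r) = fst (snd r) \<and> fst (fst r) = fst (snd z) \<and>
        covers_gap (fst r) (snd r) (fst (snd (snd z)))))"
    by (rule lifted ptime_bex_rule ptime_covers_gap ptime_rules)+
  show "ptime (D \<times> UNIV) (enc_pair e enc_label) enc_label (\<lambda>z. snd z)"
    by (rule ptime_rules)+
qed

lemma ptime_touch_labels:
  assumes n: "ptime D e enc_nat n" and p: "ptime D e (enc_pair enc_nat enc_nat) p"
    and K: "ptime D e (enc_list enc_label) K" and ys: "ptime D e (enc_list (enc_pair enc_nat enc_nat)) ys"
  shows "ptime D e (enc_list (enc_pair enc_nat enc_nat)) (\<lambda>x. touch_labels (n x) (p x) (K x) (ys x))"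
  unfolding touch_labels_def
proof (rule ptime_collect[OF _ _ K ys])
  note lifted = n[THEN ptime_lift] p[THEN ptime_lift]
  show "ptime (D \<times> UNIV) (enc_pair e enc_label) enc_bool
     (\<lambda>z. fst (snd z) = fst (p (fst z)) \<and> 0 < snd (p (fst z)) \<and> snd (p (fst z)) \<le> n (fst z) \<and>
        (snd (p (fst z)) = fst (snd (snd z)) \<or> snd (p (fst z)) = Suc (fst (snd (snd z)))))"
    by (rule lifted ptime_rules)+
  show "ptime (D \<times> UNIV) (enc_pair e enc_label) (enc_pair enc_nat enc_nat) (\<lambda>z. (snd (snd (snd z)), snd (p (fst z))))"
    by (rule lifted ptime_rules)+
qed

lemma ptime_step:
  assumes n: "ptime D e enc_nat n" and s: "ptime D e (enc_pair (enc_list enc_label) (enc_list (enc_pair enc_nat enc_nat))) s"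
    and m: "ptime D e enc_move m"
  shows "ptime D e (enc_pair (enc_list enc_label) (enc_list (enc_pair enc_nat enc_nat))) (\<lambda>x. step (n x) (s x) (m x))"
  unfolding step_def
  by (rule n s m[unfolded enc_move_def enc_point_def] ptime_add_labels ptime_drop_labels ptime_touch_labels ptime_rules)+

lemma size_enc_list_le: "(\<And>x. x \<in> set l \<Longrightarrow> size (e x) \<le> m) \<Longrightarrow> size (enc_list e l) \<le> length l * (m + 1)"
proof (induction l)
  case (Cons x l)
  have "size (e x) \<le> m" using Cons.prems by simp
  moreover have "size (enc_list e l) \<le> length l * (m + 1)" using Cons.prems by (intro Cons.IH) auto
  ultimately show ?case by simp
qed simp

lemma numbered_prefix:
  "foldl (\<lambda>s x. (Suc (fst s), (x, Suc (fst s)) # snd s)) (k, ys) xs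
    = (k + length xs, rev (zip xs [Suc k..<Suc (k + length xs)]) @ ys)"
proof (induction xs arbitrary: k ys)
  case (Cons x xs)
  have "[Suc k..<Suc (k + length (x # xs))] = Suc k # [Suc (Suc k)..<Suc (Suc k + length xs)]"
    by (subst upt_rec) simp
  then show ?case using Cons.IH[of "Suc k"] by simp
qed simp

lemma fst_numbered: "fst (numbered xs) = length xs"
  unfolding numbered_def numbered_prefix by simp

lemma set_numbered: "set (snd (numbered xs)) = point_set xs"
proof -
  have "set (zip xs [Suc 0..<Suc (length xs)]) = point_set xs"
  proof
    show "set (zip xs [Suc 0..<Suc (length xs)]) \<subseteq> point_set xs"
      unfolding point_set_def by (force simp: in_set_zip simp del: upt_Suc)
    show "point_set xs \<subseteq> set (zip xs [Suc 0..<Suc (length xs)])"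
    proof
      fix p assume "p \<in> point_set xs"
      then obtain i where "p = (xs ! (i - 1), i)" "i \<in> {1..length xs}" by (auto simp: point_set_def)
      then show "p \<in> set (zip xs [Suc 0..<Suc (length xs)])"
        unfolding in_set_zip by (intro exI[of _ "i - 1"]) (auto simp del: upt_Suc)
    qed
  qed
  then show ?thesis unfolding numbered_def numbered_prefix by simp
qed

lemma length_numbered: "length (snd (numbered xs)) = length xs"
  unfolding numbered_def numbered_prefix by (simp del: upt_Suc)

lemma ptime_numbered:
  assumes xs: "ptime D e (enc_list enc_nat) xs"
  shows "ptime D e (enc_pair enc_nat (enc_list (enc_pair enc_nat enc_nat))) (\<lambda>x. numbered (xs x))"
  unfolding numbered_def
proof (rule ptime_fold[OF xs])
  let ?e2 = "enc_pair enc_nat (enc_list (enc_pair enc_nat enc_nat))"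
  show "ptime D e ?e2 (\<lambda>x. (0, []))" by (rule ptime_rules)+
  show "ptime (D \<times> UNIV) (enc_pair e (enc_pair enc_nat ?e2)) ?e2
     (\<lambda>z. (Suc (fst (snd (snd z))), (fst (snd z), Suc (fst (snd (snd z)))) # snd (snd (snd z))))"
    by (rule ptime_rules)+
  let ?s = "\<lambda>x. size (enc_list enc_nat (xs x))"
  show "pbound D e (\<lambda>x. ?s x + ?s x * (2 * ?s x + 2) + 1)"
    by (intro pbound_intros ptime_size xs)
  fix x j
  let ?l = "take j (xs x)"
  have len: "length ?l \<le> ?s x"
    using length_le_size_enc_list[of "xs x" enc_nat] by simp
  have "size (enc_list (enc_pair enc_nat enc_nat) (rev (zip ?l [Suc 0..<Suc (length ?l)])))
      \<le> length (rev (zip ?l [Suc 0..<Suc (length ?l)])) * ((2 * ?s x + 1) + 1)"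
  proof (rule size_enc_list_le)
    fix p assume "p \<in> set (rev (zip ?l [Suc 0..<Suc (length ?l)]))"
    then have "p \<in> set (zip ?l [Suc 0..<Suc (length ?l)])" by simp
    moreover obtain u i where p: "p = (u, i)" by (cases p)
    ultimately have "u \<in> set ?l" "i \<in> set [Suc 0..<Suc (length ?l)]"
      by (auto dest: set_zip_leftD set_zip_rightD)
    then have "u \<in> set (xs x)" "i \<le> length ?l" by (auto dest: in_set_takeD)
    then have "u < ?s x" "i \<le> ?s x"
      using size_elem_enc_list[of u "xs x" enc_nat] len by (auto simp: size_enc_nat)
    then show "size (enc_pair enc_nat enc_nat p) \<le> 2 * ?s x + 1" by (simp add: p size_enc_nat)
  qed
  also have "\<dots> \<le> ?s x * (2 * ?s x + 1 + 1)" using len by (intro mult_right_mono) (auto simp del: upt_Suc)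
  finally show "size (?e2 (foldl (\<lambda>s x. (Suc (fst s), (x, Suc (fst s)) # snd s)) (0, []) ?l))
      \<le> ?s x + ?s x * (2 * ?s x + 2) + 1"
    unfolding numbered_prefix using len by (simp add: size_enc_nat)
qed

lemma initial_labels_prefix:
  "set (foldl (\<lambda>acc x. collect (\<lambda>g. True) (\<lambda>g. (x, g, x)) gs acc) acc xs) = {(x, g, x) | x g. x \<in> set xs \<and> g \<in> set gs} \<union> set acc"
  "length (foldl (\<lambda>acc x. collect (\<lambda>g. True) (\<lambda>g. (x, g, x)) gs acc) acc xs) = length xs * length gs + length acc"
  by (induction xs arbitrary: acc) (auto simp: collect_eq)

lemma set_initial_labels: "set (initial_labels xs) = {(x, g, x) | x g. x \<in> set xs \<and> g \<in> insert 0 (set xs)}"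
  unfolding initial_labels_def initial_labels_prefix by simp

lemma ptime_initial_labels:
  assumes xs: "ptime D e (enc_list enc_nat) xs"
  shows "ptime D e (enc_list enc_label) (\<lambda>x. initial_labels (xs x))"
  unfolding initial_labels_def
proof (rule ptime_fold[OF xs ptime_Nil])
  note lifted = xs[THEN ptime_lift] xs[THEN ptime_lift, THEN ptime_lift]
  let ?e2 = "enc_list enc_label"
  show "ptime (D \<times> UNIV) (enc_pair e (enc_pair enc_nat ?e2)) ?e2
     (\<lambda>z. collect (\<lambda>g. True) (\<lambda>g. (fst (snd z), g, fst (snd z))) (0 # xs (fst z)) (snd (snd z)))"
  proof (rule ptime_collect)
    let ?e = "enc_pair e (enc_pair enc_nat ?e2)"
    show "ptime ((D \<times> UNIV) \<times> UNIV) (enc_pair ?e enc_nat) enc_bool (\<lambda>z. True)" by (rule ptime_True)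
    show "ptime ((D \<times> UNIV) \<times> UNIV) (enc_pair ?e enc_nat) enc_label (\<lambda>z. (fst (snd (fst z)), snd z, fst (snd (fst z))))"
      by (rule ptime_rules)+
    show "ptime (D \<times> UNIV) ?e (enc_list enc_nat) (\<lambda>z. 0 # xs (fst z))"
      by (rule lifted ptime_rules)+
    show "ptime (D \<times> UNIV) ?e ?e2 (\<lambda>z. snd (snd z))" by (rule ptime_rules)+
  qed
  let ?s = "\<lambda>x. size (enc_list enc_nat (xs x))"
  show "pbound D e (\<lambda>x. ?s x * (?s x + 1) * (3 * ?s x + 3))"
    by (intro pbound_intros ptime_size xs)
  fix x j
  let ?l = "take j (xs x)" and ?K = "foldl (\<lambda>acc u. collect (\<lambda>g. True) (\<lambda>g. (u, g, u)) (0 # xs x) acc) [] (take j (xs x))"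
  have len: "length (xs x) \<le> ?s x" by (rule length_le_size_enc_list)
  have "size (?e2 ?K) \<le> length ?K * ((3 * ?s x + 2) + 1)"
  proof (rule size_enc_list_le)
    fix t assume "t \<in> set ?K"
    then obtain u g where "t = (u, g, u)" "u \<in> set (xs x)" "g = 0 \<or> g \<in> set (xs x)"
      unfolding initial_labels_prefix by (auto dest: in_set_takeD)
    then show "size (enc_label t) \<le> 3 * ?s x + 2"
      using size_elem_enc_list[of u "xs x" enc_nat] size_elem_enc_list[of g "xs x" enc_nat]
      by (auto simp: size_enc_nat)
  qed
  also have "\<dots> \<le> ?s x * (?s x + 1) * (3 * ?s x + 3)"
  proof -
    have "length ?K = length ?l * length (0 # xs x) + length ([] :: (nat \<times> nat \<times> nat) list)"
      by (rule initial_labels_prefix(2))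
    also have "\<dots> = length ?l * (length (xs x) + 1)" by simp
    also have "\<dots> \<le> ?s x * (?s x + 1)" using len by (intro mult_le_mono) auto
    finally have "length ?K * (3 * ?s x + 2 + 1) \<le> ?s x * (?s x + 1) * (3 * ?s x + 2 + 1)"
      by (rule mult_right_mono) simp
    then show ?thesis by (simp only: add.assoc) simp
  qed
  finally show "size (?e2 ?K) \<le> ?s x * (?s x + 1) * (3 * ?s x + 3)" .
qed

section \<open>Size bounds along the run\<close>

definition wf_labels :: "nat \<Rightarrow> (nat \<times> nat \<times> nat) list \<Rightarrow> bool" where
  "wf_labels n K \<longleftrightarrow> distinct (map (\<lambda>t. (fst t, fst (snd t))) K) \<and>
     (\<forall>t\<in>set K. fst t \<le> n \<and> fst (snd t) \<le> n \<and> snd (snd t) \<le> n)"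

text \<open>Column and strip form a key, and distinct keys leave room for only quadratically many
  entries. This provides the bound on intermediate results that \<open>ptime_fold\<close> asks for,
  without any geometry.\<close>

lemma length_wf_labels:
  assumes "wf_labels n K"
  shows "length K \<le> (n + 1) * (n + 1)"
proof -
  let ?k = "map (\<lambda>t. (fst t, fst (snd t))) K"
  have "length K = card (set ?k)" using assms distinct_card[of ?k] by (simp add: wf_labels_def)
  also have "\<dots> \<le> card ({..n} \<times> {..n})"
    using assms by (intro card_mono) (auto simp: wf_labels_def)
  finally show ?thesis by (simp add: card_cartesian_product)
qed

text \<open>Two sources in one strip cannot both be the nearest on the left, and no copy is made
  where column \<open>fst a\<close> already has a label in that strip. So no key is
  duplicated.\<close>

lemma wf_add_labels:
  assumes "wf_labels n K"
  shows "wf_labels n (add_labels n a b K)"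
proof -
  let ?key = "\<lambda>t :: nat \<times> nat \<times> nat. (fst t, fst (snd t))"
  define Q where "Q = (\<lambda>t :: nat \<times> nat \<times> nat. fst a = fst b \<and> fst a \<le> n \<and> covers_gap a b (fst (snd t)) \<and> fst t < fst a \<and>
        \<not> (\<exists>u\<in>set K. fst (snd u) = fst (snd t) \<and> fst t < fst u \<and> fst u \<le> fst a))"
  have eq: "add_labels n a b K = rev (map (\<lambda>t. (fst a, snd t)) (filter Q K)) @ K"
    unfolding add_labels_def collect_eq Q_def ..
  have dK: "distinct (map ?key K)" and bd: "\<forall>t\<in>set K. fst t \<le> n \<and> fst (snd t) \<le> n \<and> snd (snd t) \<le> n"
    using assms by (auto simp: wf_labels_def)
  have inj: "inj_on ?key (set K)" using dK by (simp add: distinct_map)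
  have "inj_on (\<lambda>t. (fst a, fst (snd t))) (set (filter Q K))"
  proof (rule inj_onI)
    fix t u assume tu: "t \<in> set (filter Q K)" "u \<in> set (filter Q K)"
      and "(fst a, fst (snd t)) = (fst a, fst (snd u))"
    then have g: "fst (snd t) = fst (snd u)" by simp
    have "\<not> fst t < fst u" "\<not> fst u < fst t" using tu g unfolding Q_def by auto
    then have "?key t = ?key u" using g by simp
    then show "t = u" using inj tu by (auto dest: inj_onD)
  qed
  moreover have "distinct (filter Q K)" using dK by (simp add: distinct_map)
  ultimately have d: "distinct (map (\<lambda>t. (fst a, fst (snd t))) (filter Q K))"
    by (simp add: distinct_map)
  have "(fst a, fst (snd t)) \<noteq> ?key u" if "t \<in> set (filter Q K)" "u \<in> set K" for t u
    using that unfolding Q_def by auto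
  then have "distinct (map ?key (add_labels n a b K))"
    unfolding eq using d dK by (auto simp: rev_map[symmetric] comp_def)
  moreover have "\<forall>t\<in>set (add_labels n a b K). fst t \<le> n \<and> fst (snd t) \<le> n \<and> snd (snd t) \<le> n"
    unfolding eq using bd by (auto simp: Q_def)
  ultimately show ?thesis by (simp add: wf_labels_def)
qed

lemma wf_drop_labels: "wf_labels n K \<Longrightarrow> wf_labels n (drop_labels R K)"
  unfolding drop_labels_def collect_eq wf_labels_def by (auto simp: rev_map[symmetric] distinct_map_filter)

lemma wf_initial_labels:
  assumes "is_permutation xs"
  shows "wf_labels (length xs) (initial_labels xs)"
proof -
  let ?key = "\<lambda>t :: nat \<times> nat \<times> nat. (fst t, fst (snd t))"
  have xs: "set xs = {1..length xs}" "distinct xs"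
    using assms by (auto simp: is_permutation_def permutations_of_set_def)
  have "distinct (map ?key (foldl (\<lambda>acc x. collect (\<lambda>g. True) (\<lambda>g. (x, g, x)) gs acc) acc ys))"
    if "distinct (map ?key acc)" "distinct ys" "distinct gs" "\<And>t. t \<in> set acc \<Longrightarrow> fst t \<notin> set ys" for acc ys and gs :: "nat list"
    using that
  proof (induction ys arbitrary: acc)
    case (Cons y ys)
    let ?acc = "collect (\<lambda>g. True) (\<lambda>g. (y, g, y)) gs acc"
    have "distinct (map (Pair y) gs)" using Cons.prems(3) by (simp add: distinct_map inj_on_def)
    then have "distinct (map ?key ?acc)"
      using Cons.prems(1,4) by (force simp: collect_eq rev_map[symmetric] comp_def)
    moreover have "fst t \<notin> set ys" if "t \<in> set ?acc" for t
      using that Cons.prems(2) Cons.prems(4)[of t] by (auto simp: collect_eq)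
    ultimately show ?case using Cons.IH[of ?acc] Cons.prems by simp
  qed simp
  from this[of "[]" xs "0 # xs"] have "distinct (map ?key (initial_labels xs))"
    using xs by (simp add: initial_labels_def)
  then show ?thesis using xs by (auto simp: wf_labels_def set_initial_labels)
qed

definition wf_run :: "nat \<Rightarrow> nat \<Rightarrow> (nat \<times> nat \<times> nat) list \<times> point list \<Rightarrow> bool" where
  "wf_run n k s \<longleftrightarrow> wf_labels n (fst s) \<and> length (snd s) \<le> k \<and> (\<forall>p\<in>set (snd s). fst p \<le> n \<and> snd p \<le> n)"

text \<open>The list of points may contain repetitions, so its length is bounded through the number
  of labels, once for each endpoint. The sharper count of four per flip concerns the set of
  points.\<close>

lemma wf_run_step:
  assumes "wf_run n k s"
  shows "wf_run n (k + 2 * ((n + 1) * (n + 1))) (step n s m)"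
proof -
  define K where "K = add_labels n (fst m) (fst (snd m)) (fst s)"
  have K: "wf_labels n K" using assms wf_add_labels by (simp add: wf_run_def K_def)
  have touch: "length (touch_labels n p K ys) \<le> length ys + (n + 1) * (n + 1)" for p ys
  proof -
    have "length (touch_labels n p K ys) \<le> length K + length ys"
      unfolding touch_labels_def by (rule length_collect)
    then show ?thesis using length_wf_labels[OF K] by linarith
  qed
  have bound: "\<forall>q\<in>set (touch_labels n p K ys). fst q \<le> n \<and> snd q \<le> n" if "\<forall>q\<in>set ys. fst q \<le> n \<and> snd q \<le> n" for p ys
    using that K unfolding touch_labels_def set_collect wf_labels_def by auto
  have "length (touch_labels n (fst m) K (touch_labels n (fst (snd m)) K (snd s))) \<le> k + 2 * ((n + 1) * (n + 1))"
    using touch[of "fst m" "touch_labels n (fst (snd m)) K (snd s)"] touch[of "fst (snd m)" "snd s"] assms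
    unfolding wf_run_def by linarith
  moreover have "\<forall>q\<in>set (touch_labels n (fst m) K (touch_labels n (fst (snd m)) K (snd s))). fst q \<le> n \<and> snd q \<le> n"
    using assms by (intro bound) (simp add: wf_run_def)
  ultimately show ?thesis
    using wf_drop_labels[OF K] unfolding wf_run_def step_def K_def[symmetric] fst_conv snd_conv by blast
qed

lemma wf_run_foldl: "wf_run n k s \<Longrightarrow> wf_run n (k + length ms * (2 * ((n + 1) * (n + 1)))) (foldl (step n) s ms)"
proof (induction ms arbitrary: k s)
  case (Cons m ms)
  from Cons.IH[OF wf_run_step[OF Cons.prems]] show ?case by (simp add: algebra_simps)
qed simp

lemma wf_run_size:
  assumes "wf_run n k s"
  shows "size (enc_pair (enc_list enc_label) (enc_list (enc_pair enc_nat enc_nat)) s)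
    \<le> (n + 1) * (n + 1) * (3 * n + 3) + k * (2 * n + 2) + 1"
proof -
  have "size (enc_list enc_label (fst s)) \<le> length (fst s) * ((3 * n + 2) + 1)"
    using assms by (intro size_enc_list_le) (auto simp: wf_run_def wf_labels_def size_enc_nat)
  also have "\<dots> \<le> (n + 1) * (n + 1) * ((3 * n + 2) + 1)"
    using assms length_wf_labels by (intro mult_right_mono) (auto simp: wf_run_def)
  finally have 1: "size (enc_list enc_label (fst s)) \<le> (n + 1) * (n + 1) * ((3 * n + 2) + 1)" .
  have "size (enc_list (enc_pair enc_nat enc_nat) (snd s)) \<le> length (snd s) * ((2 * n + 1) + 1)"
    using assms by (intro size_enc_list_le) (auto simp: wf_run_def size_enc_nat)
  also have "\<dots> \<le> k * ((2 * n + 1) + 1)"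
    using assms by (intro mult_right_mono) (auto simp: wf_run_def)
  finally have "size (enc_list (enc_pair enc_nat enc_nat) (snd s)) \<le> k * ((2 * n + 1) + 1)" .
  with 1 show ?thesis by (cases s) (simp add: numeral_eq_Suc)
qed

lemma ptime_transform:
  "ptime {(xs, ms). is_permutation xs} (enc_pair (enc_list enc_nat) (enc_list enc_move)) (enc_list (enc_pair enc_nat enc_nat))
     (\<lambda>z. transform (fst z) (snd z))"
  unfolding transform_def
proof (rule ptime_snd, rule ptime_fold)
  let ?D = "{(xs, ms). is_permutation xs} :: (nat list \<times> move list) set"
  let ?e = "enc_pair (enc_list enc_nat) (enc_list enc_move)"
  let ?e2 = "enc_pair (enc_list enc_label) (enc_list (enc_pair enc_nat enc_nat))"
  have xs: "ptime ?D ?e (enc_list enc_nat) fst" using ptime_fst[OF ptime_id, of ?D] .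
  have ms: "ptime ?D ?e (enc_list enc_move) snd" using ptime_snd[OF ptime_id, of ?D] .
  show "ptime ?D ?e (enc_list enc_move) (\<lambda>z. snd z)" by (rule ms)
  show "ptime ?D ?e ?e2 (\<lambda>z. (initial_labels (fst z), snd (numbered (fst z))))"
    by (rule ptime_Pair ptime_snd ptime_initial_labels ptime_numbered xs)+
  show "ptime (?D \<times> UNIV) (enc_pair ?e (enc_pair enc_move ?e2)) ?e2
     (\<lambda>z. step (fst (numbered (fst (fst z)))) (snd (snd z)) (fst (snd z)))"
    by (rule ptime_step ptime_numbered ptime_rules)+
  let ?s = "\<lambda>z. size (?e z)"
  show "pbound ?D ?e (\<lambda>z. (?s z + 1) * (?s z + 1) * (3 * ?s z + 3)
      + (?s z + ?s z * (2 * ((?s z + 1) * (?s z + 1)))) * (2 * ?s z + 2) + 1)"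
    by (intro pbound_intros)
  fix z :: "nat list \<times> move list" and j assume "z \<in> ?D"
  then obtain xs ms where z: "z = (xs, ms)" and perm: "is_permutation xs" by auto
  let ?n = "length xs" and ?k = "length xs + length (take j ms) * (2 * ((length xs + 1) * (length xs + 1)))"
  have "wf_run ?n ?n (initial_labels xs, snd (numbered xs))"
    using wf_initial_labels[OF perm] perm
    by (auto simp: wf_run_def length_numbered set_numbered point_set_def is_permutation_def permutations_of_set_def
        dest: nth_mem)
  from wf_run_size[OF wf_run_foldl[OF this]]
  have "size (?e2 (foldl (step ?n) (initial_labels xs, snd (numbered xs)) (take j ms)))
    \<le> (?n + 1) * (?n + 1) * (3 * ?n + 3) + ?k * (2 * ?n + 2) + 1" .
  also have "\<dots> \<le> (?s z + 1) * (?s z + 1) * (3 * ?s z + 3)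
      + (?s z + ?s z * (2 * ((?s z + 1) * (?s z + 1)))) * (2 * ?s z + 2) + 1"
  proof -
    have "?n \<le> ?s z" "length (take j ms) \<le> ?s z"
      using length_le_size_enc_list[of xs enc_nat] length_le_size_enc_list[of ms enc_move] by (auto simp: z)
    then show ?thesis by (intro add_mono mult_le_mono) auto
  qed
  finally show "size (?e2 (foldl (step (fst (numbered (fst z)))) (initial_labels (fst z), snd (numbered (fst z))) (take j (snd z))))
    \<le> (?s z + 1) * (?s z + 1) * (3 * ?s z + 3)
      + (?s z + ?s z * (2 * ((?s z + 1) * (?s z + 1)))) * (2 * ?s z + 2) + 1"
    by (simp only: z fst_conv snd_conv fst_numbered)
qed

lemma poly_time_transform: "poly_time_transformation transform"
proof -
  let ?e = "enc_pair (enc_list enc_nat) (enc_list enc_move)"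
  obtain p T where p: "\<And>z. z \<in> {(xs, ms). is_permutation xs} \<Longrightarrow>
      exec p (?e z) (enc_list (enc_pair enc_nat enc_nat) (transform (fst z) (snd z))) (T z)"
    and T: "pbound {(xs, ms). is_permutation xs} ?e T"
    using ptime_exec[OF ptime_transform] by blast
  obtain k where k: "\<And>z. z \<in> {(xs, ms). is_permutation xs} \<Longrightarrow> T z \<le> (size (?e z) + 2) ^ k"
    using T unfolding pbound_def by blast
  \<comment> \<open>Converts the base s + 2 into the required form with s alone, using s + 2 \<le> 3
    * s for positive s.\<close>
  have poly: "(s + 2) ^ k \<le> 3 ^ k * s ^ k + 3 ^ k" for s :: nat
  proof (cases "s = 0")
    case True
    have "(2::nat) ^ k \<le> 3 ^ k" by (rule power_mono) simp_all
    then show ?thesis using True by (simp add: numeral_2_eq_2 trans_le_add2)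
  next
    case False
    then have "(s + 2) ^ k \<le> (3 * s) ^ k" by (intro power_mono) auto
    then show ?thesis by (simp add: power_mult_distrib)
  qed
  have "\<exists>t. exec p (enc_instance xs ms) (enc_list enc_point (transform xs ms)) t
      \<and> t \<le> 3 ^ k * size (enc_instance xs ms) ^ k + 3 ^ k" if "is_permutation xs" for xs ms
  proof -
    have z: "(xs, ms) \<in> {(xs, ms). is_permutation xs}" using that by simp
    have e: "?e (xs, ms) = enc_instance xs ms" by (simp add: enc_instance_def)
    show ?thesis
      using p[OF z] order_trans[OF k[OF z] poly] unfolding e enc_point_def by auto
  qed
  then show ?thesis unfolding poly_time_transformation_def by blast
qed

section \<open>Correctness\<close>

definition labelled :: "nat \<Rightarrow> state \<Rightarrow> (nat \<times> nat \<times> nat) list \<times> point list \<Rightarrow> bool" where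
  "labelled n st s \<longleftrightarrow> labelling n (fst st) (vedge (snd st)) (hedge (snd st)) (set (fst s)) (set (snd s))"

lemma vedge_pairs:
  assumes "\<And>c d. (c, d) \<in> R \<Longrightarrow> axis_parallel {c, d}"
  shows "vedge ((\<lambda>(c, d). {c, d}) ` R) x g \<longleftrightarrow> (\<exists>(c, d)\<in>R. fst c = fst d \<and> x = fst c \<and> covers_gap c d g)"
proof -
  have "(x, g) \<in> seg_points {c, d} \<and> (x, Suc g) \<in> seg_points {c, d} \<longleftrightarrow>
      fst c = fst d \<and> x = fst c \<and> covers_gap c d g" if "(c, d) \<in> R" for c d
    using assms[OF that] box_vedge[of c d x g] by (simp add: seg_points_pair axis_parallel_pair)
  then show ?thesis unfolding vedge_def by fastforce
qed

text \<open>A move is a flip followed by a removal, and both intermediate and final state are valid,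
  so the two preservation results apply in turn. The 4 stands for two endpoints with two bordering
  strips each.\<close>

lemma labelled_step:
  assumes s: "labelled n (P, L) s" and L: "\<And>s. s \<in> L \<Longrightarrow> axis_parallel s"
    and flip: "valid_flip n a b (P, L)" "flip a b (P, L) = (P', L')"
    and R: "removed = map (\<lambda>(c, d). {c, d}) R" "set removed \<subseteq> L'"
    and valid: "valid_state n (P', L' - set removed)"
  shows "labelled n (P', L' - set removed) (step n s (a, b, R))"
    and "card (set (snd (step n s (a, b, R)))) \<le> card (set (snd s)) + 4"
    and "set (snd s) \<subseteq> set (snd (step n s (a, b, R)))"
proof -
  define K1 where "K1 = add_labels n a b (fst s)"
  have setK1: "set K1 = set (fst s) \<union> new_labels n a b (set (fst s))"
    unfolding K1_def by (rule set_add_labels)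
  have ab: "axis_parallel {a, b}" and valid': "valid_state n (P', L')"
    using flip by (auto simp: valid_flip_def axis_parallel_def)
  have P': "P' = P \<union> {a, b}" and abL': "{a, b} \<in> L'" using flip(2) by (auto simp: flip_def)
  have V': "vedge L' = (\<lambda>x g. vedge L x g \<or> fst a = fst b \<and> x = fst a \<and> covers_gap a b g)"
    using flip_edges(1)[OF L ab flip(2)] by blast
  have old: "labelling n P (vedge L) (hedge L) (set (fst s)) (set (snd s))"
    using s by (simp add: labelled_def)
  have inner: "(fst a, y) \<notin> P"
    if y: "fst a = fst b" "min (snd a) (snd b) < y" "y < max (snd a) (snd b)" for y
  proof
    assume "(fst a, y) \<in> P"
    moreover have "(fst a, y) \<in> seg_points {a, b}"
      using y by (cases a, cases b) (auto simp: seg_points_pair box_def)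
    ultimately have "(fst a, y) \<in> {a, b}"
      using valid_ends[OF valid' abL'] P' by blast
    then have "y = snd a \<or> y = snd b" by (metis insertE singletonD snd_conv)
    then show False using y by auto
  qed
  have "labelling n P' (vedge L') (hedge L') (set K1)
      (set (snd s) \<union> touched n a (set K1) \<union> touched n b (set K1))"
    unfolding P' V' setK1
  proof (rule labelling.flip[OF old])
    show "good n (P \<union> {a, b}) (\<lambda>x g. vedge L x g \<or> fst a = fst b \<and> x = fst a \<and> covers_gap a b g) (hedge L')"
      using valid_good[OF valid'] unfolding P' V' .
    show "hedge L x y \<Longrightarrow> hedge L' x y" for x y by (rule flip_edges(2)[OF L ab flip(2)])
  qed (rule inner)
  moreover have out: "set (snd (step n s (a, b, R))) = set (snd s) \<union> touched n a (set K1) \<union> touched n b (set K1)"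
    by (auto simp: step_def set_touch_labels K1_def)
  ultimately have new: "labelling n P' (vedge L') (hedge L') (set K1) (set (snd (step n s (a, b, R))))"
    by simp
  show "set (snd s) \<subseteq> set (snd (step n s (a, b, R)))" unfolding out by blast
  have "card (set (snd (step n s (a, b, R)))) \<le> card (set (snd s) \<union> touched n a (set K1)) + card (touched n b (set K1))"
    unfolding out by (rule card_Un_le)
  also have "\<dots> \<le> card (set (snd s)) + card (touched n a (set K1)) + card (touched n b (set K1))"
    using card_Un_le by (intro add_right_mono)
  also have "\<dots> \<le> card (set (snd s)) + 4"
    using labelling.card_touched[OF new, of a] labelling.card_touched[OF new, of b] by linarith
  finally show "card (set (snd (step n s (a, b, R)))) \<le> card (set (snd s)) + 4" .
  have Rax: "axis_parallel {c, d}" if "(c, d) \<in> set R" for c d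
  proof (rule valid_axis_parallel[OF valid'])
    show "{c, d} \<in> L'" using R that by force
  qed
  have V'': "vedge (L' - set removed) x g \<longleftrightarrow>
      vedge L' x g \<and> \<not> (\<exists>(c, d)\<in>set R. fst c = fst d \<and> x = fst c \<and> covers_gap c d g)" for x g
    using removal_edges[OF valid' R(2)] vedge_pairs[OF Rax, where R = "set R"] R(1) by simp
  have "set (fst (step n s (a, b, R))) = {(x, g, f) \<in> set K1. vedge (L' - set removed) x g}"
    unfolding V'' using labelling.range[OF new] by (auto simp: step_def set_drop_labels K1_def)
  moreover have "labelling n P' (vedge (L' - set removed)) (hedge (L' - set removed))
      {(x, g, f) \<in> set K1. vedge (L' - set removed) x g} (set (snd (step n s (a, b, R))))"
  proof (rule labelling.removal[OF new])
    show "good n P' (vedge (L' - set removed)) (hedge (L' - set removed))" by (rule valid_good[OF valid])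
  qed (auto simp: vedge_def hedge_def)
  ultimately show "labelled n (P', L' - set removed) (step n s (a, b, R))"
    by (simp add: labelled_def)
qed

text \<open>The last conjunct prepares the count of flips: a row without horizontal edges at the
  start acquires one only through a flip whose first endpoint lies in it.\<close>

lemma labelled_moves:
  assumes "moves n st ms st'" and "labelled n st s" and "\<And>s. s \<in> snd st \<Longrightarrow> axis_parallel s"
  shows "labelled n st' (foldl (step n) s ms)
    \<and> card (set (snd (foldl (step n) s ms))) \<le> card (set (snd s)) + 4 * length ms
    \<and> set (snd s) \<subseteq> set (snd (foldl (step n) s ms))
    \<and> (\<forall>x y. hedge (snd st') x y \<longrightarrow> hedge (snd st) x y \<or> y \<in> (\<lambda>m. snd (fst m)) ` set ms)"
  using assms
proof (induction arbitrary: s rule: moves.induct)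
  case (Cons a b st P L removed R ms st')
  obtain P0 L0 where st: "st = (P0, L0)" by (cases st)
  have L0: "axis_parallel s" if "s \<in> L0" for s using Cons.prems(2) that st by simp
  have s: "labelled n (P0, L0) s" and f: "valid_flip n a b (P0, L0)" "flip a b (P0, L0) = (P, L)"
    using Cons.prems(1) Cons.hyps(1,2) by (simp_all add: st)
  note step = labelled_step[OF s L0 f Cons.hyps(3,5,6)]
  have ab: "axis_parallel {a, b}" using f by (auto simp: valid_flip_def axis_parallel_def)
  have "axis_parallel s" if "s \<in> L - set removed" for s
    using valid_axis_parallel[OF Cons.hyps(6) that] .
  then have IH: "labelled n st' (foldl (step n) (step n s (a, b, R)) ms)"
    "card (set (snd (foldl (step n) (step n s (a, b, R)) ms))) \<le> card (set (snd (step n s (a, b, R)))) + 4 * length ms"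
    "set (snd (step n s (a, b, R))) \<subseteq> set (snd (foldl (step n) (step n s (a, b, R)) ms))"
    "\<And>x y. hedge (snd st') x y \<Longrightarrow> hedge (L - set removed) x y \<or> y \<in> (\<lambda>m. snd (fst m)) ` set ms"
    using Cons.IH[OF step(1)] by auto
  have "hedge L0 x y \<or> y \<in> (\<lambda>m. snd (fst m)) ` set ((a, b, R) # ms)" if "hedge (snd st') x y" for x y
  proof -
    have "hedge L x y \<or> y \<in> (\<lambda>m. snd (fst m)) ` set ms"
      using IH(4)[OF that] by (auto simp: hedge_def)
    then show ?thesis using flip_edges(3)[OF L0 ab f(2)] by auto
  qed
  then show ?case using IH(1-3) step(2,3) by (auto simp: st)
qed simp

section \<open>The initial state, and the count of points\<close>

context
  fixes xs :: "nat list"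
  assumes perm: "is_permutation xs"
begin

lemma perm_set: "set xs = {1..length xs}"
  using perm by (simp add: is_permutation_def permutations_of_set_def)

lemma point_set_grid: "point_set xs \<subseteq> {1..length xs} \<times> {1..length xs}"
  using perm_set nth_mem by (fastforce simp: point_set_def)

lemma point_set_column:
  assumes "x \<in> {1..length xs}"
  obtains y where "(x, y) \<in> point_set xs"
proof -
  obtain i where "i < length xs" "xs ! i = x" using assms perm_set by (metis in_set_conv_nth)
  then have "(x, Suc i) \<in> point_set xs" by (auto simp: point_set_def)
  then show ?thesis by (rule that)
qed

lemma initial_segments:
  assumes "s \<in> snd (initial_state xs)"
  obtains x y where "(x, y) \<in> point_set xs" "s = {(x, 0), (x, y)} \<or> s = {(x, y), (x, length xs + 1)}"
  using assms unfolding initial_state_def by auto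

lemma initial_axis_parallel:
  assumes "s \<in> snd (initial_state xs)"
  shows "axis_parallel s"
proof -
  obtain x y where xy: "(x, y) \<in> point_set xs" "s = {(x, 0), (x, y)} \<or> s = {(x, y), (x, length xs + 1)}"
    using assms by (rule initial_segments)
  then have "y \<in> {1..length xs}" using point_set_grid by blast
  then show ?thesis using xy(2) by (auto simp: axis_parallel_pair)
qed

lemma initial_hedge: "\<not> hedge (snd (initial_state xs)) x y"
proof
  assume "hedge (snd (initial_state xs)) x y"
  then obtain s where s: "s \<in> snd (initial_state xs)" "(x, y) \<in> seg_points s" "(Suc x, y) \<in> seg_points s"
    by (auto simp: hedge_def)
  obtain x' y' where "s = {(x', 0), (x', y')} \<or> s = {(x', y'), (x', length xs + 1)}"
    using s(1) by (rule initial_segments)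
  then show False using s(2,3) by (auto simp: seg_points_pair box_def)
qed

lemma initial_vedge:
  assumes "x \<in> {1..length xs}" "g \<le> length xs"
  shows "vedge (snd (initial_state xs)) x g"
proof -
  obtain y where y: "(x, y) \<in> point_set xs" using assms(1) by (rule point_set_column)
  then have "{(x, 0), (x, y)} \<in> snd (initial_state xs)" "{(x, y), (x, length xs + 1)} \<in> snd (initial_state xs)"
    unfolding initial_state_def by force+
  moreover have "(x, g) \<in> seg_points {(x, 0), (x, y)} \<and> (x, Suc g) \<in> seg_points {(x, 0), (x, y)} \<or>
    (x, g) \<in> seg_points {(x, y), (x, length xs + 1)} \<and> (x, Suc g) \<in> seg_points {(x, y), (x, length xs + 1)}"
    using assms(2) by (auto simp: seg_points_pair box_def)
  ultimately show ?thesis unfolding vedge_def by blast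
qed

text \<open>Every column from 1 to n carries its own index in all strips, so \<open>pairs\<close>
  holds because all labels are present. Any other first coordinate has neither labels nor points of
  Y.\<close>

lemma labelled_initial: "labelled (length xs) (initial_state xs) (initial_labels xs, snd (numbered xs))"
proof -
  let ?n = "length xs" and ?L = "snd (initial_state xs)"
  let ?K = "{(x, g, x) | x g. x \<in> {1..?n} \<and> g \<in> {0..?n}}"
  have K: "set (initial_labels xs) = ?K"
    unfolding set_initial_labels perm_set by auto
  have al: "alive ?K f g \<longleftrightarrow> f \<in> {1..?n} \<and> g \<le> ?n" for f g by (auto simp: alive_def)
  have nonmargin: "(x, y) \<in> fst (initial_state xs) \<longleftrightarrow> (x, y) \<in> point_set xs"
    if "x \<in> {1..?n}" "y \<in> {1..?n}" for x y
    using that by (auto simp: initial_state_def margin_def)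
  have "labelling ?n (fst (initial_state xs)) (vedge ?L) (hedge ?L) ?K (point_set xs)"
  proof (unfold_locales, goal_cases)
    case 1
    show ?case unfolding good_def using initial_vedge initial_hedge by auto
  next
    case (2 x g f)
    then show ?case using initial_vedge by auto
  next
    case (7 f y x)
    then show ?case using nonmargin[of x y] by auto
  next
    case (8 f y g)
    then have "f \<in> {1..?n}" "y \<in> {1..?n}" using point_set_grid by auto
    then show ?case using 8 nonmargin[of f y] by (intro exI[of _ f]) auto
  next
    case 9
    show ?case by (rule point_set_grid)
  next
    case (10 x1 x2 y1 y2)
    show ?case
    proof (cases "x1 \<in> {1..?n} \<and> x2 \<in> {1..?n}")
      case True
      have "\<forall>g\<in>{min y1 y2..<max y1 y2}. g \<le> ?n" using 10 by auto
      then show ?thesis using True unfolding al by blast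
    next
      case False
      then show ?thesis using point_set_grid unfolding al by blast
    qed
  qed auto
  then show ?thesis unfolding labelled_def K[symmetric] by (simp add: set_numbered)
qed

text \<open>The constant is 5 = 4 + 1: each flip adds at most four points, and the n input points
  are paid by the flips as well. Every row starts without horizontal edges and is covered in the
  end, so distinct rows need distinct flips and there are at least n of them.\<close>

lemma transform_correct:
  assumes "rectangulation_solution xs ms"
  shows "superset_solution xs (transform xs ms)" and "superset_cost (transform xs ms) \<le> 5 * rectangulation_cost ms"
proof -
  let ?n = "length xs"
  obtain P L where mv: "moves ?n (initial_state xs) ms (P, L)" and fin: "end_state xs (P, L)"
    using assms unfolding rectangulation_solution_def by (metis surj_pair)
  have "labelled ?n (P, L) (foldl (step ?n) (initial_labels xs, snd (numbered xs)) ms)"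
    and card: "card (set (transform xs ms)) \<le> card (point_set xs) + 4 * length ms"
    and sup: "point_set xs \<subseteq> set (transform xs ms)"
    and rows: "\<And>x y. hedge L x y \<Longrightarrow> y \<in> (\<lambda>m. snd (fst m)) ` set ms"
    using labelled_moves[OF mv labelled_initial initial_axis_parallel] initial_hedge
    by (auto simp: transform_def fst_numbered set_numbered)
  then have lab: "labelling ?n P (vedge L) (hedge L)
      (set (fst (foldl (step ?n) (initial_labels xs, snd (numbered xs)) ms))) (set (transform xs ms))"
    by (simp add: labelled_def transform_def fst_numbered)
  have hor: "horizontal s" if "s \<in> L" for s using fin that by (auto simp: end_state_def)
  have cov: "{0..?n + 1} \<times> {1..?n} \<subseteq> (\<Union>s\<in>L. seg_points s)" using fin by (auto simp: end_state_def)
  have "\<not> vedge L x g" for x g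
  proof
    assume "vedge L x g"
    then obtain s where s: "s \<in> L" "(x, g) \<in> seg_points s" "(x, Suc g) \<in> seg_points s" by (auto simp: vedge_def)
    obtain a b where "s = {a, b}" "snd a = snd b" using hor[OF s(1)] by (auto simp: horizontal_def)
    then show False using s(2,3) by (auto simp: seg_points_pair box_def)
  qed
  from labelling.satisfied_if_no_vertical[OF lab this] labelling.Y_grid[OF lab] sup
  show "superset_solution xs (transform xs ms)" by (simp add: superset_solution_def)
  have "{1..?n} \<subseteq> (\<lambda>m. snd (fst m)) ` set ms"
  proof
    fix y assume y: "y \<in> {1..?n}"
    then obtain s where s: "s \<in> L" "(0, y) \<in> seg_points s" using cov by force
    obtain a b where ab: "s = {a, b}" "a \<noteq> b" "snd a = snd b"
      using hor[OF s(1)] by (auto simp: horizontal_def)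
    \<comment> \<open>Column 0 is the left border, so a horizontal segment that covers (0, y) must
      extend to the right.\<close>
    have "(Suc 0, y) \<in> seg_points s" using s(2) ab
      by (cases a, cases b) (auto simp: seg_points_pair box_def)
    then have "hedge L 0 y" using s by (auto simp: hedge_def)
    then show "y \<in> (\<lambda>m. snd (fst m)) ` set ms" by (rule rows)
  qed
  then have "card {1..?n} \<le> card ((\<lambda>m. snd (fst m)) ` set ms)" by (intro card_mono) auto
  also have "\<dots> \<le> card (set ms)" by (rule card_image_le) simp
  also have "\<dots> \<le> length ms" by (rule card_length)
  finally have "?n \<le> length ms" by simp
  moreover have "card (point_set xs) \<le> ?n"
  proof -
    have "point_set xs = (\<lambda>i. (xs ! (i - 1), i)) ` {1..?n}" by (auto simp: point_set_def)
    then show ?thesis by (metis card_atLeastAtMost card_image_le diff_Suc_1 finite_atLeastAtMost)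
  qed
  ultimately show "superset_cost (transform xs ms) \<le> 5 * rectangulation_cost ms"
    using card by (simp add: superset_cost_def rectangulation_cost_def)
qed

end

theorem theorem2:
  shows "\<exists>T. poly_time_transformation T \<and>
    (\<exists>c::nat. \<forall>A. rectangulation_algorithm A \<longrightarrow>
       (let A' = (\<lambda>xs. T xs (A xs)) in
          superset_algorithm A' \<and>
          (\<forall>xs. is_permutation xs \<longrightarrow>
             superset_cost (A' xs) \<le> c * rectangulation_cost (A xs))))"
proof (intro exI conjI allI impI)
  show "poly_time_transformation transform" by (rule poly_time_transform)
  fix A assume "rectangulation_algorithm A"
  then have A: "rectangulation_solution xs (A xs)" if "is_permutation xs" for xs
    using that by (simp add: rectangulation_algorithm_def)
  show "let A' = (\<lambda>xs. transform xs (A xs)) in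
          superset_algorithm A' \<and>
          (\<forall>xs. is_permutation xs \<longrightarrow> superset_cost (A' xs) \<le> 5 * rectangulation_cost (A xs))"
    using transform_correct A by (simp add: superset_algorithm_def)
qed

end
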